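(* Let $n\in\mathbb{N}$. Then $$\begin{aligned}N_{(1,1)}(n)&=16\sigma(n)-64\sigma(\tfrac n4)+64W_{(1,1)}(n)+1024W_{(1,1)}(\tfrac n4)-512W_{(1,4)}(n)\\&=16\sigma_3(n)-32\sigma_3(\tfrac n2)+256\sigma_3(\tfrac n4),\end{aligned}$$ $$N_{(1,3)}(n)=8\sigma(n)-32\sigma(\tfrac n4)+8\sigma(\tfrac n3)-32\sigma(\tfrac n{12})+64W_{(1,3)}(n)+1024W_{(1,3)}(\tfrac n4)-256\bigl(W_{(3,4)}(n)+W_{(1,12)}(n)\bigr),$$ $$N_{(2,3)}(n)=8\sigma(\tfrac n2)-32\sigma(\tfrac n8)+8\sigma(\tfrac n3)-32\sigma(\tfrac n{12})+64W_{(2,3)}(n)+1024W_{(2,3)}(\tfrac n4)-256\bigl(W_{(3,8)}(n)+W_{(2,12)}(n)\bigr),$$ $$N_{(1,9)}(n)=8\sigma(n)-32\sigma(\tfrac n4)+8\sigma(\tfrac n9)-32\sigma(\tfrac n{36})+64W_{(1,9)}(n)+1024W_{(1,9)}(\tfrac n4)-256\bigl(W_{(4,9)}(n)+W_{(1,36)}(n)\bigr).$$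
   Context: $\mathbb{N}$ is the set of positive integers, $\mathbb{N}_0=\mathbb{N}\cup\{0\}$. $\sigma_k(n)=\sum_{0<d\mid n}d^k$ for $n\in\mathbb{N}$, $\sigma=\sigma_1$, and $\sigma_k(m)=0$ for $m\notin\mathbb{N}$. $W_{(r,s)}(n)=\sum_{(l,m)\in\mathbb{N}_0^2,\ rl+sm=n}\sigma(l)\sigma(m)$, which is $0$ if $n$ is not an integer. $N_{(a,b)}(n)$ is the number of $(x_1,\dots,x_8)\in\mathbb{Z}^8$ with $n=a(x_1^2+x_2^2+x_3^2+x_4^2)+b(x_5^2+x_6^2+x_7^2+x_8^2)$. *)

theory Defs
  imports Complex_Main
begin

text \<open>The arguments of \<open>\<sigma>\<^sub>k\<close> and \<open>W\<close> are rational, so that expressions such as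
  \<open>\<sigma>(n/4)\<close> are genuine quotients, which evaluate to \<open>0\<close> when \<open>4\<close> does not divide \<open>n\<close>.
  Values are integers because the identities involve subtraction.\<close>

definition divisor_sigma :: "nat \<Rightarrow> rat \<Rightarrow> int" where
  "divisor_sigma k q =
     (if q \<in> \<nat> \<and> q > 0 then (\<Sum>d | 0 < d \<and> d dvd nat \<lfloor>q\<rfloor>. int d ^ k) else 0)"

abbreviation sigma1 :: "rat \<Rightarrow> int" where
  "sigma1 \<equiv> divisor_sigma 1"

text \<open>For \<open>r, s > 0\<close> the index set is finite, and it is empty if \<open>q\<close> is not a
  nonnegative integer.\<close>

definition conv_W :: "nat \<Rightarrow> nat \<Rightarrow> rat \<Rightarrow> int" where
  "conv_W r s q =
     (\<Sum>(l, m) | of_nat (r * l + s * m) = q. sigma1 (of_nat l) * sigma1 (of_nat m))"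

text \<open>For \<open>a, b > 0\<close> the set of representations is finite.\<close>

definition num_reps :: "nat \<Rightarrow> nat \<Rightarrow> nat \<Rightarrow> nat" where
  "num_reps a b n =
     card {(x1, x2, x3, x4, x5, x6, x7, x8).
             int n = int a * (x1\<^sup>2 + x2\<^sup>2 + x3\<^sup>2 + x4\<^sup>2) + int b * (x5\<^sup>2 + x6\<^sup>2 + x7\<^sup>2 + x8\<^sup>2)}"

end

theory Submission
  imports Defs
begin

text \<open>The four squares theorem of Jacobi carries everything: if \<open>r\<^sub>4(m)\<close> counts the representations of
  \<open>m\<close> as a sum of four squares, then \<open>r\<^sub>4(m) = [m = 0] + 8 \<sigma>(m) - 32 \<sigma>(m/4)\<close>. Splitting a
  representation by \<open>n = a (x\<^sub>1\<^sup>2 + \<dots> + x\<^sub>4\<^sup>2) + b (x\<^sub>5\<^sup>2 + \<dots> + x\<^sub>8\<^sup>2)\<close> into the values \<open>l\<close>, \<open>m\<close> of its two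
  quadruples gives \<open>N\<^bsub>(a,b)\<^esub>(n) = \<Sum> r\<^sub>4(l) r\<^sub>4(m)\<close> over \<open>a l + b m = n\<close>. Multiplying out the product
  produces divisor sums (from \<open>l = 0\<close> or \<open>m = 0\<close>) and convolution sums, where an argument \<open>l/4\<close>
  replaces the coefficient \<open>a\<close> by \<open>4 a\<close>. This is lemma \<open>num_reps_formula\<close>, of which all the formulas
  with \<open>W\<close> are instances.

  Jacobi's theorem is proved without theta functions. The number \<open>r\<^sub>4\<close> satisfies
  \<open>\<Sum>\<^sub>i (n - 5 i\<^sup>2) r\<^sub>4(n - i\<^sup>2) = 0\<close> for every \<open>n\<close>: this is the sum of \<open>x\<^sub>1\<^sup>2 + \<dots> + x\<^sub>5\<^sup>2 - 5 x\<^sub>1\<^sup>2\<close> over all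
  representations of \<open>n\<close> by five squares, and the five coordinates play the same role. For \<open>n > 0\<close> the
  term at \<open>i = 0\<close> is \<open>n r\<^sub>4(n)\<close>, so the recursion and \<open>r\<^sub>4(0) = 1\<close> determine \<open>r\<^sub>4\<close>
  (\<open>square_recursion_unique\<close>). The divisor side satisfies the same recursion
  (\<open>four_squares_value_recursion\<close>), which comes out of an identity of Uspensky for sums over
  \<open>n = i\<^sup>2 + d e\<close>, applied to a cubic polynomial restricted by parity conditions.

  For eight squares one also needs \<open>\<Sum> r\<^sub>4(l) r\<^sub>4(n - l)\<close> in terms of \<open>\<sigma>\<^sub>3\<close>. For \<open>m > 0\<close>, \<open>r\<^sub>4(m)\<close> is \<open>8\<close> or \<open>24\<close>
  times the sum of the odd divisors of \<open>m\<close>, according to the parity of \<open>m\<close>, so this convolution reduces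
  to that of the odd divisor sum with itself (\<open>odd_conv_value\<close>). Liouville's identity for sums over
  \<open>a x + b y = n\<close>, applied to \<open>f(t) = t\<^sup>2\<close> and to its restriction to even \<open>t\<close>, evaluates the latter.\<close>

section \<open>Liouville's identity\<close>

definition divpairs :: "int \<Rightarrow> (int \<times> int) set" where
  "divpairs n = {(d, e). 0 < d \<and> 0 < e \<and> d * e = n}"

definition quads :: "int \<Rightarrow> (int \<times> int \<times> int \<times> int) set" where
  "quads n = {(a, b, x, y). 0 < a \<and> 0 < b \<and> 0 < x \<and> 0 < y \<and> a * x + b * y = n}"

lemma factor_le_product:
  fixes a b :: int
  assumes "0 < a" "0 < b"
  shows "a \<le> a * b" "b \<le> a * b"
  using assms by (simp_all add: mult_le_cancel_left1 mult_le_cancel_right1)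

lemma finite_divpairs [simp, intro]: "finite (divpairs n)"
proof (rule finite_subset)
  show "divpairs n \<subseteq> {1..n} \<times> {1..n}"
    using factor_le_product by (fastforce simp: divpairs_def)
qed auto

lemma finite_quads [simp, intro]: "finite (quads n)"
proof (rule finite_subset)
  show "quads n \<subseteq> {1..n} \<times> {1..n} \<times> {1..n} \<times> {1..n}"
  proof
    fix q
    assume "q \<in> quads n"
    then obtain a b x y where q: "q = (a, b, x, y)" and pos: "0 < a" "0 < b" "0 < x" "0 < y"
      and n: "a * x + b * y = n"
      by (auto simp: quads_def)
    show "q \<in> {1..n} \<times> {1..n} \<times> {1..n} \<times> {1..n}"
      unfolding q mem_Times_iff atLeastAtMost_iff fst_conv snd_conv
      using pos n factor_le_product[OF pos(1,3)] factor_le_product[OF pos(2,4)]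
      by (intro conjI) linarith+
  qed
qed auto

lemma sum_trichotomy:
  fixes g h :: "'a \<Rightarrow> int" and f :: "'a \<Rightarrow> int"
  assumes "finite A"
  shows "sum f A = sum f {x \<in> A. g x < h x} + sum f {x \<in> A. g x = h x} + sum f {x \<in> A. h x < g x}"
proof -
  have "A = {x \<in> A. g x < h x} \<union> {x \<in> A. g x = h x} \<union> {x \<in> A. h x < g x}" by auto
  then have "sum f A = sum f ({x \<in> A. g x < h x} \<union> {x \<in> A. g x = h x} \<union> {x \<in> A. h x < g x})"
    by (rule arg_cong)
  also have "\<dots> = sum f {x \<in> A. g x < h x} + sum f {x \<in> A. g x = h x} + sum f {x \<in> A. h x < g x}"
    using assms by (subst sum.union_disjoint; auto)+
  finally show ?thesis .
qed

text \<open>On the diagonals \<open>a = b\<close> and \<open>x = y\<close> the equation \<open>a x + b y = n\<close> collapses to a factorization of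
  \<open>n\<close>: \<open>a (x + y) = n\<close>, respectively \<open>(a + b) x = n\<close>, together with a way to split one factor.\<close>

lemma sum_quads_equal_left:
  fixes g :: "int \<Rightarrow> int"
  shows "(\<Sum>(a, b, x, y) \<in> {(a, b, x, y) \<in> quads n. a = b}. g a) = (\<Sum>(d, e) \<in> divpairs n. g d * (e - 1))"
proof -
  have "(\<Sum>(a, b, x, y) \<in> {(a, b, x, y) \<in> quads n. a = b}. g a)
      = (\<Sum>((d, e), x) \<in> Sigma (divpairs n) (\<lambda>(d, e). {1..<e}). g d)"
    by (rule sum.reindex_bij_witness[of _ "\<lambda>((d, e), x). (d, d, x, e - x)"
          "\<lambda>(a, b, x, y). ((a, x + y), x)"])
       (auto simp: quads_def divpairs_def algebra_simps)
  also have "\<dots> = (\<Sum>(d, e) \<in> divpairs n. \<Sum>x \<in> {1..<e}. g d)"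
    by (subst sum.Sigma[symmetric]) (auto intro!: sum.cong)
  also have "\<dots> = (\<Sum>(d, e) \<in> divpairs n. g d * (e - 1))"
    by (intro sum.cong) (auto simp: divpairs_def)
  finally show ?thesis .
qed

lemma sum_quads_equal_right:
  fixes g :: "int \<Rightarrow> int \<Rightarrow> int"
  shows "(\<Sum>(a, b, x, y) \<in> {(a, b, x, y) \<in> quads n. x = y}. g (a + b) b)
    = (\<Sum>(d, e) \<in> divpairs n. \<Sum>l \<in> {1..<d}. g d l)"
proof -
  have "(\<Sum>(a, b, x, y) \<in> {(a, b, x, y) \<in> quads n. x = y}. g (a + b) b)
      = (\<Sum>((d, e), l) \<in> Sigma (divpairs n) (\<lambda>(d, e). {1..<d}). g d l)"
    by (rule sum.reindex_bij_witness[of _ "\<lambda>((d, e), l). (d - l, l, e, e)"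
          "\<lambda>(a, b, x, y). ((a + b, x), b)"])
       (auto simp: quads_def divpairs_def algebra_simps)
  also have "\<dots> = (\<Sum>(d, e) \<in> divpairs n. \<Sum>l \<in> {1..<d}. g d l)"
    by (subst sum.Sigma[symmetric]) (auto intro!: sum.cong)
  finally show ?thesis .
qed

text \<open>The equation \<open>a x + b y = n\<close> is invariant under the shear \<open>(a, b, x, y) \<mapsto> (a, a + b, x - y, y)\<close>,
  which maps the region \<open>y < x\<close> onto the region \<open>a < b\<close>. Off the diagonals it turns \<open>f(a + b)\<close> and
  \<open>f(b - a)\<close> into values \<open>f(b)\<close>, summed over one of these two regions; the sums of \<open>f(b)\<close> over the two
  regions differ by diagonal terms only, by a further shear that fixes \<open>b\<close>.\<close>

lemma liouville_identity:
  fixes f :: "int \<Rightarrow> int"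
  assumes even: "\<And>t. f (- t) = f t"
  shows "(\<Sum>(a, b, x, y) \<in> quads n. f (a - b) - f (a + b))
    = (\<Sum>(d, e) \<in> divpairs n.
         (f 0 + 2 * f d) * (e - 1) - f d * (d - 1) - 2 * (\<Sum>l \<in> {1..<d}. f l))"
proof -
  define Q where "Q P = {(a, b, x, y) \<in> quads n. P a b x y}" for P
  note tri_ab = sum_trichotomy[OF finite_quads, where g = "\<lambda>(a, b, x, y). a" and h = "\<lambda>(a, b, x, y). b" and n1 = n]
  note tri_xy = sum_trichotomy[OF finite_quads, where g = "\<lambda>(a, b, x, y). x" and h = "\<lambda>(a, b, x, y). y" and n1 = n]
  have Qab: "{q \<in> quads n. (case q of (a, b, x, y) \<Rightarrow> a) < (case q of (a, b, x, y) \<Rightarrow> b)} = Q (\<lambda>a b x y. a < b)"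
    "{q \<in> quads n. (case q of (a, b, x, y) \<Rightarrow> a) = (case q of (a, b, x, y) \<Rightarrow> b)} = Q (\<lambda>a b x y. a = b)"
    "{q \<in> quads n. (case q of (a, b, x, y) \<Rightarrow> b) < (case q of (a, b, x, y) \<Rightarrow> a)} = Q (\<lambda>a b x y. b < a)"
    "{q \<in> quads n. (case q of (a, b, x, y) \<Rightarrow> x) < (case q of (a, b, x, y) \<Rightarrow> y)} = Q (\<lambda>a b x y. x < y)"
    "{q \<in> quads n. (case q of (a, b, x, y) \<Rightarrow> x) = (case q of (a, b, x, y) \<Rightarrow> y)} = Q (\<lambda>a b x y. x = y)"
    "{q \<in> quads n. (case q of (a, b, x, y) \<Rightarrow> y) < (case q of (a, b, x, y) \<Rightarrow> x)} = Q (\<lambda>a b x y. y < x)"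
    by (auto simp: Q_def)
  have swap_ab: "(\<Sum>(a, b, x, y) \<in> Q (\<lambda>a b x y. b < a). f (a - b)) = (\<Sum>(a, b, x, y) \<in> Q (\<lambda>a b x y. a < b). f (b - a))"
    by (rule sum.reindex_bij_witness[of _ "\<lambda>(a, b, x, y). (b, a, y, x)" "\<lambda>(a, b, x, y). (b, a, y, x)"])
       (auto simp: Q_def quads_def algebra_simps)
  have swap_xy: "(\<Sum>(a, b, x, y) \<in> Q (\<lambda>a b x y. x < y). f (a + b)) = (\<Sum>(a, b, x, y) \<in> Q (\<lambda>a b x y. y < x). f (a + b))"
    by (rule sum.reindex_bij_witness[of _ "\<lambda>(a, b, x, y). (b, a, y, x)" "\<lambda>(a, b, x, y). (b, a, y, x)"])
       (auto simp: Q_def quads_def algebra_simps)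
  have shift_minus: "(\<Sum>(a, b, x, y) \<in> Q (\<lambda>a b x y. a < b). f (b - a)) = (\<Sum>(a, b, x, y) \<in> Q (\<lambda>a b x y. y < x). f b)"
    by (rule sum.reindex_bij_witness[of _ "\<lambda>(a, b, x, y). (a, a + b, x - y, y)" "\<lambda>(a, b, x, y). (a, b - a, x + y, y)"])
       (auto simp: Q_def quads_def algebra_simps)
  have shift_plus: "(\<Sum>(a, b, x, y) \<in> Q (\<lambda>a b x y. y < x). f (a + b)) = (\<Sum>(a, b, x, y) \<in> Q (\<lambda>a b x y. a < b). f b)"
    by (rule sum.reindex_bij_witness[of _ "\<lambda>(a, b, x, y). (a, b - a, x + y, y)" "\<lambda>(a, b, x, y). (a, a + b, x - y, y)"])
       (auto simp: Q_def quads_def algebra_simps)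
  have shift_fixed: "(\<Sum>(a, b, x, y) \<in> Q (\<lambda>a b x y. b < a). f b) = (\<Sum>(a, b, x, y) \<in> Q (\<lambda>a b x y. x < y). f b)"
    by (rule sum.reindex_bij_witness[of _ "\<lambda>(a, b, x, y). (a + b, b, x, y - x)" "\<lambda>(a, b, x, y). (a - b, b, x, x + y)"])
       (auto simp: Q_def quads_def algebra_simps)
  have reflect: "(\<Sum>(a, b, x, y) \<in> Q (\<lambda>a b x y. a < b). f (a - b)) = (\<Sum>(a, b, x, y) \<in> Q (\<lambda>a b x y. a < b). f (b - a))"
    using even by (intro sum.cong) (auto, metis minus_diff_eq)
  have minus: "(\<Sum>(a, b, x, y) \<in> quads n. f (a - b))
      = (\<Sum>(a, b, x, y) \<in> Q (\<lambda>a b x y. a = b). f 0) + 2 * (\<Sum>(a, b, x, y) \<in> Q (\<lambda>a b x y. y < x). f b)"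
  proof -
    have "(\<Sum>(a, b, x, y) \<in> Q (\<lambda>a b x y. a = b). f (a - b)) = (\<Sum>(a, b, x, y) \<in> Q (\<lambda>a b x y. a = b). f 0)"
      by (rule sum.cong) (auto simp: Q_def)
    then show ?thesis
      using tri_ab[of "\<lambda>(a, b, x, y). f (a - b)"] swap_ab shift_minus reflect by (simp add: Qab)
  qed
  have plus: "(\<Sum>(a, b, x, y) \<in> quads n. f (a + b))
      = (\<Sum>(a, b, x, y) \<in> Q (\<lambda>a b x y. x = y). f (a + b)) + 2 * (\<Sum>(a, b, x, y) \<in> Q (\<lambda>a b x y. a < b). f b)"
    using tri_xy[of "\<lambda>(a, b, x, y). f (a + b)"] swap_xy shift_plus by (simp add: Qab)
  have diff: "(\<Sum>(a, b, x, y) \<in> Q (\<lambda>a b x y. y < x). f b) - (\<Sum>(a, b, x, y) \<in> Q (\<lambda>a b x y. a < b). f b)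
      = (\<Sum>(a, b, x, y) \<in> Q (\<lambda>a b x y. a = b). f b) - (\<Sum>(a, b, x, y) \<in> Q (\<lambda>a b x y. x = y). f b)"
    using tri_ab[of "\<lambda>(a, b, x, y). f b"] tri_xy[of "\<lambda>(a, b, x, y). f b"] shift_fixed by (simp add: Qab)
  have d1: "(\<Sum>(a, b, x, y) \<in> Q (\<lambda>a b x y. a = b). f 0) = (\<Sum>(d, e) \<in> divpairs n. f 0 * (e - 1))"
    unfolding Q_def using sum_quads_equal_left[where n = n and g = "\<lambda>_. f 0"] by simp
  have "(\<Sum>(a, b, x, y) \<in> Q (\<lambda>a b x y. a = b). f b) = (\<Sum>(a, b, x, y) \<in> Q (\<lambda>a b x y. a = b). f a)"
    by (rule sum.cong) (auto simp: Q_def)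
  then have d2: "(\<Sum>(a, b, x, y) \<in> Q (\<lambda>a b x y. a = b). f b) = (\<Sum>(d, e) \<in> divpairs n. f d * (e - 1))"
    unfolding Q_def using sum_quads_equal_left[where n = n and g = f] by simp
  have d3: "(\<Sum>(a, b, x, y) \<in> Q (\<lambda>a b x y. x = y). f b) = (\<Sum>(d, e) \<in> divpairs n. \<Sum>l \<in> {1..<d}. f l)"
    unfolding Q_def using sum_quads_equal_right[where n = n and g = "\<lambda>_. f"] by simp
  have "(\<Sum>(a, b, x, y) \<in> Q (\<lambda>a b x y. x = y). f (a + b)) = (\<Sum>(d, e) \<in> divpairs n. \<Sum>l \<in> {1..<d}. f d)"
    unfolding Q_def using sum_quads_equal_right[where n = n and g = "\<lambda>d _. f d"] by simp
  also have "\<dots> = (\<Sum>(d, e) \<in> divpairs n. f d * (d - 1))"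
    by (intro sum.cong) (auto simp: divpairs_def)
  finally have d4: "(\<Sum>(a, b, x, y) \<in> Q (\<lambda>a b x y. x = y). f (a + b)) = (\<Sum>(d, e) \<in> divpairs n. f d * (d - 1))" .
  have "(\<Sum>(a, b, x, y) \<in> quads n. f (a - b) - f (a + b))
      = (\<Sum>(a, b, x, y) \<in> quads n. f (a - b)) - (\<Sum>(a, b, x, y) \<in> quads n. f (a + b))"
    by (simp add: sum_subtractf case_prod_unfold)
  also have "\<dots> = (\<Sum>(d, e) \<in> divpairs n. f 0 * (e - 1)) - (\<Sum>(d, e) \<in> divpairs n. f d * (d - 1))
      + 2 * (\<Sum>(d, e) \<in> divpairs n. f d * (e - 1)) - 2 * (\<Sum>(d, e) \<in> divpairs n. \<Sum>l \<in> {1..<d}. f l)"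
    using minus plus diff d1 d2 d3 d4 by linarith
  also have "\<dots> = (\<Sum>(d, e) \<in> divpairs n.
         (f 0 + 2 * f d) * (e - 1) - f d * (d - 1) - 2 * (\<Sum>l \<in> {1..<d}. f l))"
    unfolding sum_distrib_left sum_subtractf[symmetric] sum.distrib[symmetric]
    by (intro sum.cong) (auto simp: algebra_simps sum_distrib_left)
  finally show ?thesis .
qed

section \<open>Uspensky's identity\<close>

definition sqdiv :: "int \<Rightarrow> (int \<times> int \<times> int) set" where
  "sqdiv n = {(i, d, e). 0 < d \<and> 0 < e \<and> i\<^sup>2 + d * e = n}"

lemma abs_le_square: "\<bar>i\<bar> \<le> (i::int)\<^sup>2"
proof (cases "i = 0")
  case False
  then have "\<bar>i\<bar> * 1 \<le> \<bar>i\<bar> * \<bar>i\<bar>" by (intro mult_left_mono) auto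
  then show ?thesis by (simp add: power2_eq_square)
qed simp

lemma finite_sqdiv [simp, intro]: "finite (sqdiv n)"
proof (rule finite_subset)
  show "sqdiv n \<subseteq> {-n..n} \<times> {1..n} \<times> {1..n}"
  proof
    fix q
    assume "q \<in> sqdiv n"
    then obtain i d e where q: "q = (i, d, e)" and pos: "0 < d" "0 < e" and n: "i\<^sup>2 + d * e = n"
      by (auto simp: sqdiv_def)
    show "q \<in> {-n..n} \<times> {1..n} \<times> {1..n}"
      unfolding q mem_Times_iff atLeastAtMost_iff fst_conv snd_conv
      using pos n factor_le_product[OF pos] abs_le_square[of i] by (intro conjI) linarith+
  qed
qed auto

definition quadric :: "int \<Rightarrow> (int \<times> int \<times> int) set" where
  "quadric n = {(x, y, z). 4 * y\<^sup>2 + x\<^sup>2 = z\<^sup>2 + 4 * n}"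

lemma quadric_parity:
  assumes "(x, y, z) \<in> quadric n"
  shows "even (x + z)"
proof -
  have "4 * y\<^sup>2 + x\<^sup>2 = z\<^sup>2 + 4 * n" using assms by (simp add: quadric_def)
  then have "even (x\<^sup>2) \<longleftrightarrow> even (z\<^sup>2)" by (metis dvd_add_right_iff even_mult_iff even_numeral dvd_add_left_iff)
  then show "even (x + z)" by auto
qed

text \<open>Both maps below send a decomposition \<open>n = i\<^sup>2 + d e\<close> to a point of the quadric, because
  \<open>4 (d + i)\<^sup>2 + (e - 2 i)\<^sup>2 - (2 d + 2 i - e)\<^sup>2\<close> and \<open>4 i\<^sup>2 + (d + e)\<^sup>2 - (d - e)\<^sup>2\<close> both equal
  \<open>4 (i\<^sup>2 + d e)\<close>. Integrality of the inverse is the parity lemma; positivity of \<open>d\<close> and \<open>e\<close>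
  becomes the region that is cut out of the quadric.\<close>

lemma sqdiv_bij_oblique:
  "bij_betw (\<lambda>(i, d, e). (e - 2 * i, d + i, 2 * d + 2 * i - e)) (sqdiv n)
     {(x, y, z) \<in> quadric n. z < 2 * y \<and> - z < x}"
proof (rule bij_betw_byWitness[where f' = "\<lambda>(x, y, z). (y - (x + z) div 2, (x + z) div 2, 2 * y - z)"])
  have inverse: "(y - (x + z) div 2, (x + z) div 2, 2 * y - z) \<in> sqdiv n"
    if Q: "(x, y, z) \<in> quadric n" and r: "z < 2 * y" "- z < x" for x y z
  proof -
    obtain w where w: "x + z = 2 * w" using quadric_parity[OF Q] by (blast elim: evenE)
    then have x: "x = 2 * w - z" by simp
    have "(y - w)\<^sup>2 + w * (2 * y - z) = n"
      using Q unfolding x quadric_def by (simp add: power2_eq_square algebra_simps)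
    then show ?thesis using r by (simp add: w sqdiv_def x)
  qed
  show "(\<lambda>(x, y, z). (y - (x + z) div 2, (x + z) div 2, 2 * y - z))
      ` {(x, y, z) \<in> quadric n. z < 2 * y \<and> - z < x} \<subseteq> sqdiv n"
    by (auto simp: inverse)
  show "\<forall>q \<in> {(x, y, z) \<in> quadric n. z < 2 * y \<and> - z < x}.
      (case (case q of (x, y, z) \<Rightarrow> (y - (x + z) div 2, (x + z) div 2, 2 * y - z)) of
        (i, d, e) \<Rightarrow> (e - 2 * i, d + i, 2 * d + 2 * i - e)) = q"
  proof
    fix q
    assume "q \<in> {(x, y, z) \<in> quadric n. z < 2 * y \<and> - z < x}"
    then obtain x y z where q: "q = (x, y, z)" and Q: "(x, y, z) \<in> quadric n" by auto
    obtain w where w: "x + z = 2 * w" using quadric_parity[OF Q] by (blast elim: evenE)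
    then have x: "x = 2 * w - z" by simp
    show "(case (case q of (x, y, z) \<Rightarrow> (y - (x + z) div 2, (x + z) div 2, 2 * y - z)) of
        (i, d, e) \<Rightarrow> (e - 2 * i, d + i, 2 * d + 2 * i - e)) = q"
      by (simp add: q w) (simp add: x)
  qed
qed (auto simp: sqdiv_def quadric_def power2_eq_square algebra_simps)

lemma sqdiv_bij_symmetric:
  "bij_betw (\<lambda>(i, d, e). (d + e, i, d - e)) (sqdiv n) {(x, y, z) \<in> quadric n. \<bar>z\<bar> < x}"
proof (rule bij_betw_byWitness[where f' = "\<lambda>(x, y, z). (y, (x + z) div 2, (x - z) div 2)"])
  have inverse: "(y, (x + z) div 2, (x - z) div 2) \<in> sqdiv n
      \<and> (x + z) div 2 + (x - z) div 2 = x \<and> (x + z) div 2 - (x - z) div 2 = z"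
    if Q: "(x, y, z) \<in> quadric n" and r: "\<bar>z\<bar> < x" for x y z
  proof -
    obtain w where w: "x + z = 2 * w" using quadric_parity[OF Q] by (blast elim: evenE)
    then have x: "x = 2 * w - z" by simp
    have h: "(x - z) div 2 = w - z" by (simp add: x)
    have "y\<^sup>2 + w * (w - z) = n"
      using Q unfolding x quadric_def by (simp add: power2_eq_square algebra_simps)
    then show ?thesis using r by (auto simp: w h sqdiv_def x)
  qed
  show "(\<lambda>(x, y, z). (y, (x + z) div 2, (x - z) div 2)) ` {(x, y, z) \<in> quadric n. \<bar>z\<bar> < x} \<subseteq> sqdiv n"
    by (auto simp: inverse)
  show "\<forall>q \<in> {(x, y, z) \<in> quadric n. \<bar>z\<bar> < x}.
      (case (case q of (x, y, z) \<Rightarrow> (y, (x + z) div 2, (x - z) div 2)) of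
        (i, d, e) \<Rightarrow> (d + e, i, d - e)) = q"
    using inverse by auto
qed (auto simp: sqdiv_def quadric_def power2_eq_square algebra_simps abs_if)

lemma sum_sqdiv_oblique:
  fixes F :: "int \<times> int \<times> int \<Rightarrow> int"
  shows "(\<Sum>(i, d, e) \<in> sqdiv n. F (e - 2 * i, d + i, 2 * d + 2 * i - e))
    = sum F {(x, y, z) \<in> quadric n. z < 2 * y \<and> - z < x}"
  using sum.reindex_bij_betw[OF sqdiv_bij_oblique, of F n] by (simp add: case_prod_unfold)

lemma sum_sqdiv_symmetric:
  fixes F :: "int \<times> int \<times> int \<Rightarrow> int"
  shows "(\<Sum>(i, d, e) \<in> sqdiv n. F (d + e, i, d - e)) = sum F {(x, y, z) \<in> quadric n. \<bar>z\<bar> < x}"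
  using sum.reindex_bij_betw[OF sqdiv_bij_symmetric, of F n] by (simp add: case_prod_unfold)

text \<open>With \<open>A\<close> the region \<open>z < 2 y, - z < x\<close> and \<open>B\<close> the region \<open>\<bar>z\<bar> < x\<close>, the part of \<open>A\<close> with \<open>x < z\<close> is
  stable under \<open>x \<mapsto> - x\<close> and cancels because \<open>F\<close> is odd in \<open>x\<close>. The part with \<open>z < x\<close> is the half
  \<open>z < 2 y\<close> of \<open>B\<close>, and \<open>(y, z) \<mapsto> (- y, - z)\<close> exchanges the two halves of \<open>B\<close>. Hence twice the sum
  over \<open>A\<close> and the sum over \<open>B\<close> agree up to the boundaries \<open>x = z\<close> and \<open>2 y = z\<close>.\<close>

lemma uspensky_identity:
  fixes F :: "int \<times> int \<times> int \<Rightarrow> int"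
  assumes odd: "\<And>x y z. F (- x, y, z) = - F (x, y, z)"
    and even: "\<And>x y z. F (x, - y, - z) = F (x, y, z)"
  shows "2 * (\<Sum>(i, d, e) \<in> sqdiv n. F (e - 2 * i, d + i, 2 * d + 2 * i - e))
       - (\<Sum>(i, d, e) \<in> sqdiv n. F (d + e, i, d - e))
    = 2 * sum F {(x, y, z) \<in> quadric n. z < 2 * y \<and> 0 < x \<and> x = z}
       - sum F {(x, y, z) \<in> quadric n. \<bar>z\<bar> < x \<and> 2 * y = z}"
proof -
  define A where "A P = {(x, y, z) \<in> quadric n. z < 2 * y \<and> - z < x \<and> P x z}" for P
  define B where "B P = {(x, y, z) \<in> quadric n. \<bar>z\<bar> < x \<and> P y z}" for P
  have finA: "finite (A P)" for P
    by (rule finite_subset[OF _ bij_betw_finite[OF sqdiv_bij_oblique, THEN iffD1, OF finite_sqdiv[of n]]]) (auto simp: A_def)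
  have finB: "finite (B P)" for P
    by (rule finite_subset[OF _ bij_betw_finite[OF sqdiv_bij_symmetric, THEN iffD1, OF finite_sqdiv[of n]]]) (auto simp: B_def)
  have "sum F (A (\<lambda>x z. x < z)) = sum (\<lambda>q. - F q) (A (\<lambda>x z. x < z))"
    by (rule sum.reindex_bij_witness[of _ "\<lambda>(x, y, z). (- x, y, z)" "\<lambda>(x, y, z). (- x, y, z)"])
       (auto simp: A_def quadric_def odd)
  then have cancel: "sum F (A (\<lambda>x z. x < z)) = 0" by (simp add: sum_negf)
  have AB: "A (\<lambda>x z. z < x) = B (\<lambda>y z. z < 2 * y)" by (auto simp: A_def B_def)
  have mirror: "sum F (B (\<lambda>y z. 2 * y < z)) = sum F (B (\<lambda>y z. z < 2 * y))"
    by (rule sum.reindex_bij_witness[of _ "\<lambda>(x, y, z). (x, - y, - z)" "\<lambda>(x, y, z). (x, - y, - z)"])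
       (auto simp: B_def quadric_def even)
  have "A (\<lambda>_ _. True) = A (\<lambda>x z. x < z) \<union> A (\<lambda>x z. z < x) \<union> A (\<lambda>x z. x = z)"
    by (auto simp: A_def)
  moreover have "sum F (A (\<lambda>x z. x < z) \<union> A (\<lambda>x z. z < x) \<union> A (\<lambda>x z. x = z))
      = sum F (A (\<lambda>x z. x < z)) + sum F (A (\<lambda>x z. z < x)) + sum F (A (\<lambda>x z. x = z))"
    using finA by (subst sum.union_disjoint; auto simp: A_def)+
  ultimately have sumA: "sum F (A (\<lambda>_ _. True)) = sum F (B (\<lambda>y z. z < 2 * y)) + sum F (A (\<lambda>x z. x = z))"
    using cancel AB by simp
  have "B (\<lambda>_ _. True) = B (\<lambda>y z. 2 * y < z) \<union> B (\<lambda>y z. z < 2 * y) \<union> B (\<lambda>y z. 2 * y = z)"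
    by (auto simp: B_def)
  moreover have "sum F (B (\<lambda>y z. 2 * y < z) \<union> B (\<lambda>y z. z < 2 * y) \<union> B (\<lambda>y z. 2 * y = z))
      = sum F (B (\<lambda>y z. 2 * y < z)) + sum F (B (\<lambda>y z. z < 2 * y)) + sum F (B (\<lambda>y z. 2 * y = z))"
    using finB by (subst sum.union_disjoint; auto simp: B_def)+
  ultimately have sumB: "sum F (B (\<lambda>_ _. True)) = 2 * sum F (B (\<lambda>y z. z < 2 * y)) + sum F (B (\<lambda>y z. 2 * y = z))"
    using mirror by simp
  have "A (\<lambda>x z. x = z) = {(x, y, z) \<in> quadric n. z < 2 * y \<and> 0 < x \<and> x = z}"
    by (auto simp: A_def)
  then show ?thesis
    using sumA sumB unfolding sum_sqdiv_oblique sum_sqdiv_symmetric by (simp add: A_def B_def)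
qed

text \<open>On the boundaries \<open>x = z\<close> and \<open>2 y = z\<close> the quadric degenerates to \<open>y\<^sup>2 = n\<close> and \<open>x\<^sup>2 = 4 n\<close>: they
  are empty unless \<open>n\<close> is a square, and otherwise each consists of one line segment.\<close>

lemma quadric_boundary_square:
  assumes "0 < s"
  shows "{(x, y, z) \<in> quadric (s\<^sup>2). z < 2 * y \<and> 0 < x \<and> x = z} = (\<lambda>j. (j, s, j)) ` {1..<2 * s}"
    and "{(x, y, z) \<in> quadric (s\<^sup>2). \<bar>z\<bar> < x \<and> 2 * y = z} = (\<lambda>y. (2 * s, y, 2 * y)) ` {-s<..<s}"
proof -
  have "y = s" if "y\<^sup>2 = s\<^sup>2" "0 < y" for y
    using that assms by (simp add: power2_eq_iff)
  then show "{(x, y, z) \<in> quadric (s\<^sup>2). z < 2 * y \<and> 0 < x \<and> x = z} = (\<lambda>j. (j, s, j)) ` {1..<2 * s}"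
    by (force simp: quadric_def image_iff)
  have "x = 2 * s" if "x\<^sup>2 = 4 * s\<^sup>2" "0 < x" for x
  proof -
    have "x\<^sup>2 = (2 * s)\<^sup>2" using that by (simp add: power_mult_distrib)
    then show ?thesis using that assms by (simp only: power2_eq_iff) linarith
  qed
  then show "{(x, y, z) \<in> quadric (s\<^sup>2). \<bar>z\<bar> < x \<and> 2 * y = z} = (\<lambda>y. (2 * s, y, 2 * y)) ` {-s<..<s}"
    by (force simp: quadric_def image_iff power_mult_distrib)
qed

lemma quadric_boundary_nonsquare:
  assumes "\<And>s. n \<noteq> s\<^sup>2"
  shows "{(x, y, z) \<in> quadric n. z < 2 * y \<and> 0 < x \<and> x = z} = {}"
    and "{(x, y, z) \<in> quadric n. \<bar>z\<bar> < x \<and> 2 * y = z} = {}"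
proof -
  show "{(x, y, z) \<in> quadric n. z < 2 * y \<and> 0 < x \<and> x = z} = {}"
    using assms by (force simp: quadric_def)
  have "x\<^sup>2 \<noteq> 4 * n" for x
  proof
    assume x: "x\<^sup>2 = 4 * n"
    then have "even (x\<^sup>2)" by simp
    then have "even x" by simp
    then obtain t where "x = 2 * t" by (auto elim: evenE)
    with x have "n = t\<^sup>2" by (simp add: power_mult_distrib)
    with assms show False by blast
  qed
  then show "{(x, y, z) \<in> quadric n. \<bar>z\<bar> < x \<and> 2 * y = z} = {}"
    by (auto simp: quadric_def power_mult_distrib)
qed

section \<open>The divisor side of the four squares theorem\<close>

text \<open>The usual \<open>\<sigma>\<^sub>k\<close> on integer arguments; it vanishes for \<open>n \<le> 0\<close>, where \<open>divpairs n\<close> is empty.\<close>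

definition sigma :: "nat \<Rightarrow> int \<Rightarrow> int" where
  "sigma k n = (\<Sum>(d, e) \<in> divpairs n. d ^ k)"

text \<open>Summed over \<open>d e = n\<close>, this weight gives the sum of the odd divisors of \<open>n\<close>, times \<open>3\<close> if \<open>n\<close> is
  even, which is \<open>\<sigma>(n) - 4 \<sigma>(n/4)\<close>. The factor \<open>3\<close> is attached to the single pair \<open>(d, e)\<close> so that the
  weight depends on the parities of \<open>d\<close> and \<open>e\<close> only, which makes it a local expression inside sums over
  \<open>n = i\<^sup>2 + d e\<close>.\<close>

definition jacobi_weight :: "int \<Rightarrow> int \<Rightarrow> int" where
  "jacobi_weight d e = (if odd d then (if odd e then d else 3 * d) else 0)"

definition four_squares_value :: "int \<Rightarrow> int" where
  "four_squares_value n = (if n = 0 then 1 else 0) + 8 * (\<Sum>(d, e) \<in> divpairs n. jacobi_weight d e)"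

text \<open>The function to insert in Uspensky's identity. The cubic monomials \<open>x z\<^sup>2\<close> and \<open>x y z\<close> are odd in \<open>x\<close>
  and even in \<open>(y, z)\<close>; the parity conditions are chosen so that, after averaging over the symmetries of
  \<open>n = i\<^sup>2 + d e\<close>, the terms in \<open>d\<^sup>3\<close> and \<open>e\<^sup>3\<close> in the identity cancel and \<open>2 (n - 5 i\<^sup>2)\<close> times the
  Jacobi weight remains.\<close>

definition test_function :: "int \<Rightarrow> int \<times> int \<times> int \<Rightarrow> int" where
  "test_function n = (\<lambda>(x, y, z).
     if odd x then x * z\<^sup>2 else if odd (y - n) then x * z\<^sup>2 + x * y * z else 0)"

lemma sum_odd_cubes:
  "(\<Sum>j \<in> {1..<2 * int s}. if odd j then j ^ 3 else 0) = int s ^ 2 * (2 * int s ^ 2 - 1)"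
proof (induction s)
  case (Suc s)
  show ?case
  proof (cases "s = 0")
    case False
    then have "{1..<2 * int (Suc s)} = insert (2 * int s) (insert (2 * int s + 1) {1..<2 * int s})"
      by auto
    then show ?thesis using Suc by (simp add: algebra_simps power2_eq_square power3_eq_cube)
  next
    case True
    have "{1..<2 * int (Suc 0)} = {1}" by auto
    then show ?thesis using True by simp
  qed
qed simp

lemma sum_alternate_squares:
  "3 * (\<Sum>y \<in> {- int s<..<int s}. if odd (y - int s) then y\<^sup>2 else 0) = int s ^ 3 - int s"
proof (induction s rule: nat_less_induct)
  case (1 s)
  consider "s = 0" | "s = 1" | t where "s = t + 2"
    by (metis One_nat_def add_2_eq_Suc' not0_implies_Suc)
  then show ?case
  proof cases
    case 2
    have "{- int 1<..<int 1} = {0}" by auto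
    then show ?thesis using 2 by simp
  next
    case 3
    show ?thesis
    proof (cases "t = 0")
      case True
      have "{- int 2<..<int 2} = {-1, 0, 1}" by auto
      then show ?thesis using 3 True by simp
    next
      case False
      have "{- int s<..<int s} = {- int t - 1, - int t, int t, int t + 1} \<union> {- int t<..<int t}"
        using 3 by auto
      moreover have "3 * (\<Sum>y \<in> {- int t<..<int t}. if odd (y - int t) then y\<^sup>2 else 0) = int t ^ 3 - int t"
        using 1 3 by simp
      ultimately show ?thesis using False 3
        by (simp add: algebra_simps power2_eq_square power3_eq_cube)
    qed
  qed simp
qed

text \<open>The boundary terms for \<open>n = s\<^sup>2\<close> amount to \<open>2 s\<^sup>2\<close>, which is what it takes to compensate the
  contribution of \<open>r\<^sub>4(0) = 1\<close>, at \<open>i = \<plusminus> s\<close>, to the recursion.\<close>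

lemma test_function_boundary:
  assumes "0 < s"
  shows "2 * sum (test_function (s\<^sup>2)) {(x, y, z) \<in> quadric (s\<^sup>2). z < 2 * y \<and> 0 < x \<and> x = z}
    - sum (test_function (s\<^sup>2)) {(x, y, z) \<in> quadric (s\<^sup>2). \<bar>z\<bar> < x \<and> 2 * y = z} = 2 * s\<^sup>2"
proof -
  obtain m where m: "s = int m" using assms by (metis zero_less_imp_eq_int)
  have "sum (test_function (s\<^sup>2)) {(x, y, z) \<in> quadric (s\<^sup>2). z < 2 * y \<and> 0 < x \<and> x = z}
      = (\<Sum>j \<in> {1..<2 * s}. test_function (s\<^sup>2) (j, s, j))"
    unfolding quadric_boundary_square(1)[OF assms] by (subst sum.reindex) (auto simp: inj_on_def)
  also have "\<dots> = (\<Sum>j \<in> {1..<2 * s}. if odd j then j ^ 3 else 0)"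
    by (intro sum.cong) (auto simp: test_function_def power2_eq_square power3_eq_cube)
  also have "\<dots> = s ^ 2 * (2 * s ^ 2 - 1)" unfolding m by (rule sum_odd_cubes)
  finally have E: "sum (test_function (s\<^sup>2)) {(x, y, z) \<in> quadric (s\<^sup>2). z < 2 * y \<and> 0 < x \<and> x = z}
      = s ^ 2 * (2 * s ^ 2 - 1)" .
  have "sum (test_function (s\<^sup>2)) {(x, y, z) \<in> quadric (s\<^sup>2). \<bar>z\<bar> < x \<and> 2 * y = z}
      = (\<Sum>y \<in> {- s<..<s}. test_function (s\<^sup>2) (2 * s, y, 2 * y))"
    unfolding quadric_boundary_square(2)[OF assms] by (subst sum.reindex) (auto simp: inj_on_def)
  also have "\<dots> = (\<Sum>y \<in> {- s<..<s}. 4 * s * (3 * (if odd (y - s) then y\<^sup>2 else 0)))"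
    by (intro sum.cong) (auto simp: test_function_def power2_eq_square)
  also have "\<dots> = 4 * s * (3 * (\<Sum>y \<in> {- s<..<s}. if odd (y - s) then y\<^sup>2 else 0))"
    by (simp only: sum_distrib_left)
  also have "\<dots> = 4 * s * (s ^ 3 - s)" unfolding m by (subst sum_alternate_squares) simp
  finally have D: "sum (test_function (s\<^sup>2)) {(x, y, z) \<in> quadric (s\<^sup>2). \<bar>z\<bar> < x \<and> 2 * y = z}
      = 4 * s * (s ^ 3 - s)" .
  show ?thesis unfolding E D by (simp add: algebra_simps power2_eq_square power3_eq_cube)
qed

text \<open>The set of solutions of \<open>n = i\<^sup>2 + d e\<close> is invariant under \<open>i \<mapsto> - i\<close> and under exchanging \<open>d\<close> and
  \<open>e\<close>, so only the average of a summand over these four symmetries matters. For the average the claim is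
  a polynomial identity in each of the parity classes of \<open>(d, e)\<close>.\<close>

lemma symmetrised_test_function:
  fixes n :: int
  defines "T \<equiv> \<lambda>i d e. 2 * test_function n (e - 2 * i, d + i, 2 * d + 2 * i - e)
      - test_function n (d + e, i, d - e) - 2 * (n - 5 * i\<^sup>2) * jacobi_weight d e"
  assumes n: "n = i\<^sup>2 + d * e"
  shows "T i d e + T (- i) d e + T i e d + T (- i) e d = 0"
proof -
  consider "odd d" "odd e" | "odd d" "even e" | "even d" "odd e" | "even d" "even e" by blast
  then show ?thesis
    by cases
       (simp_all add: T_def n test_function_def jacobi_weight_def, simp_all add: algebra_simps power2_eq_square power3_eq_cube)
qed

lemma sum_sqdiv_jacobi_weight:
  "(\<Sum>(i, d, e) \<in> sqdiv n. 2 * (n - 5 * i\<^sup>2) * jacobi_weight d e)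
    = 2 * (\<Sum>(i, d, e) \<in> sqdiv n. test_function n (e - 2 * i, d + i, 2 * d + 2 * i - e))
       - (\<Sum>(i, d, e) \<in> sqdiv n. test_function n (d + e, i, d - e))"
proof -
  define T where "T i d e = 2 * test_function n (e - 2 * i, d + i, 2 * d + 2 * i - e)
      - test_function n (d + e, i, d - e) - 2 * (n - 5 * i\<^sup>2) * jacobi_weight d e" for i d e
  have neg: "(\<Sum>(i, d, e) \<in> sqdiv n. T (- i) d e) = (\<Sum>(i, d, e) \<in> sqdiv n. T i d e)"
    by (rule sum.reindex_bij_witness[of _ "\<lambda>(i, d, e). (- i, d, e)" "\<lambda>(i, d, e). (- i, d, e)"])
       (auto simp: sqdiv_def)
  have swap: "(\<Sum>(i, d, e) \<in> sqdiv n. T i e d) = (\<Sum>(i, d, e) \<in> sqdiv n. T i d e)"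
    by (rule sum.reindex_bij_witness[of _ "\<lambda>(i, d, e). (i, e, d)" "\<lambda>(i, d, e). (i, e, d)"])
       (auto simp: sqdiv_def mult.commute)
  have both: "(\<Sum>(i, d, e) \<in> sqdiv n. T (- i) e d) = (\<Sum>(i, d, e) \<in> sqdiv n. T i d e)"
    by (rule sum.reindex_bij_witness[of _ "\<lambda>(i, d, e). (- i, e, d)" "\<lambda>(i, d, e). (- i, e, d)"])
       (auto simp: sqdiv_def mult.commute)
  have "4 * (\<Sum>(i, d, e) \<in> sqdiv n. T i d e) = (\<Sum>(i, d, e) \<in> sqdiv n. T i d e)
      + (\<Sum>(i, d, e) \<in> sqdiv n. T (- i) d e) + (\<Sum>(i, d, e) \<in> sqdiv n. T i e d)
      + (\<Sum>(i, d, e) \<in> sqdiv n. T (- i) e d)"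
    using neg swap both by linarith
  also have "\<dots> = (\<Sum>(i, d, e) \<in> sqdiv n. T i d e + T (- i) d e + T i e d + T (- i) e d)"
    unfolding sum.distrib[symmetric] by (intro sum.cong) auto
  also have "\<dots> = 0"
    by (intro sum.neutral) (use symmetrised_test_function in \<open>auto simp: T_def sqdiv_def\<close>)
  finally have "(\<Sum>(i, d, e) \<in> sqdiv n. T i d e) = 0" by simp
  then show ?thesis
    by (simp add: T_def case_prod_unfold sum_subtractf sum_distrib_left)
qed

lemma sum_sqdiv_by_square:
  fixes g :: "int \<Rightarrow> int" and h :: "int \<Rightarrow> int \<Rightarrow> int"
  shows "(\<Sum>(i, d, e) \<in> sqdiv n. g i * h d e)
    = (\<Sum>i \<in> {-n..n}. g i * (\<Sum>(d, e) \<in> divpairs (n - i\<^sup>2). h d e))"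
proof -
  have bound: "- n \<le> i \<and> i \<le> n" if "i\<^sup>2 + d * e = n" "0 < d" "0 < e" for i d e
    using that abs_le_square[of i] mult_pos_pos[of d e] by linarith
  have "(\<Sum>(i, d, e) \<in> sqdiv n. g i * h d e)
      = (\<Sum>(i, d, e) \<in> Sigma {-n..n} (\<lambda>i. divpairs (n - i\<^sup>2)). g i * h d e)"
    by (intro sum.cong) (use bound in \<open>auto simp: sqdiv_def divpairs_def\<close>)
  also have "\<dots> = (\<Sum>i \<in> {-n..n}. \<Sum>(d, e) \<in> divpairs (n - i\<^sup>2). g i * h d e)"
    by (subst sum.Sigma) auto
  finally show ?thesis by (simp add: sum_distrib_left case_prod_unfold)
qed

text \<open>In the proof, \<open>K\<close> collects the divisor sums and \<open>Z\<close> the value \<open>1\<close> at argument \<open>0\<close>, which occurs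
  when \<open>n\<close> is a square. If \<open>n = s\<^sup>2\<close>, then \<open>K = s\<^sup>2\<close> by Uspensky's identity, and \<open>i = \<plusminus> s\<close> each contribute
  \<open>n - 5 s\<^sup>2 = - 4 s\<^sup>2\<close> to \<open>Z\<close>, so that \<open>8 K + Z = 0\<close>.\<close>

lemma four_squares_value_recursion:
  assumes "0 < n"
  shows "(\<Sum>i \<in> {-n..n}. (n - 5 * i\<^sup>2) * four_squares_value (n - i\<^sup>2)) = 0"
proof -
  define w where "w m = (\<Sum>(d, e) \<in> divpairs m. jacobi_weight d e)" for m
  define K where "K = (\<Sum>i \<in> {-n..n}. (n - 5 * i\<^sup>2) * w (n - i\<^sup>2))"
  define Z where "Z = (\<Sum>i \<in> {-n..n}. (n - 5 * i\<^sup>2) * (if n - i\<^sup>2 = 0 then 1 else 0))"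
  have odd: "test_function n (- x, y, z) = - test_function n (x, y, z)"
    and even: "test_function n (x, - y, - z) = test_function n (x, y, z)" for x y z
    by (auto simp: test_function_def)
  have "2 * K = (\<Sum>(i, d, e) \<in> sqdiv n. 2 * (n - 5 * i\<^sup>2) * jacobi_weight d e)"
    unfolding K_def w_def sum_sqdiv_by_square[where g = "\<lambda>i. 2 * (n - 5 * i\<^sup>2)"]
    by (subst sum_distrib_left) (simp only: mult.assoc)
  also have "\<dots> = 2 * sum (test_function n) {(x, y, z) \<in> quadric n. z < 2 * y \<and> 0 < x \<and> x = z}
       - sum (test_function n) {(x, y, z) \<in> quadric n. \<bar>z\<bar> < x \<and> 2 * y = z}"
    unfolding sum_sqdiv_jacobi_weight by (rule uspensky_identity[OF odd even])
  finally have K: "2 * K = 2 * sum (test_function n) {(x, y, z) \<in> quadric n. z < 2 * y \<and> 0 < x \<and> x = z}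
       - sum (test_function n) {(x, y, z) \<in> quadric n. \<bar>z\<bar> < x \<and> 2 * y = z}" .
  have "8 * K + Z = 0"
  proof (cases "\<exists>s. n = s\<^sup>2")
    case True
    then obtain s' where s': "n = s'\<^sup>2" by blast
    define s where "s = \<bar>s'\<bar>"
    have s: "n = s\<^sup>2" "0 < s" using s' assms by (auto simp: s_def)
    have "K = s\<^sup>2" using K test_function_boundary[OF s(2)] s(1) by simp
    moreover have "Z = - 8 * s\<^sup>2"
    proof -
      have "Z = (\<Sum>i \<in> {s, - s}. n - 5 * i\<^sup>2)"
        unfolding Z_def
      proof (rule sum.mono_neutral_cong_right)
        show "{s, - s} \<subseteq> {-n..n}" using s abs_le_square[of s] by auto
        show "\<forall>i \<in> {-n..n} - {s, - s}. (n - 5 * i\<^sup>2) * (if n - i\<^sup>2 = 0 then 1 else 0) = 0"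
          using s by (auto simp: power2_eq_iff)
      qed (use s in auto)
      then show ?thesis using s by simp
    qed
    ultimately show ?thesis by simp
  next
    case False
    then have "K = 0" using K quadric_boundary_nonsquare[of n] by auto
    moreover have "Z = 0" unfolding Z_def by (intro sum.neutral) (use False in auto)
    ultimately show ?thesis by simp
  qed
  moreover have "(\<Sum>i \<in> {-n..n}. (n - 5 * i\<^sup>2) * four_squares_value (n - i\<^sup>2)) = 8 * K + Z"
    unfolding K_def Z_def four_squares_value_def w_def[symmetric] sum_distrib_left sum.distrib[symmetric]
    by (intro sum.cong) (auto simp: algebra_simps)
  ultimately show ?thesis by simp
qed

section \<open>Jacobi's four squares theorem\<close>

definition four_squares :: "int \<Rightarrow> (int \<times> int \<times> int \<times> int) set" where
  "four_squares n = {(a, b, c, d). a\<^sup>2 + b\<^sup>2 + c\<^sup>2 + d\<^sup>2 = n}"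

definition r4 :: "int \<Rightarrow> int" where
  "r4 n = int (card (four_squares n))"

definition five_squares :: "int \<Rightarrow> (int \<times> int \<times> int \<times> int \<times> int) set" where
  "five_squares n = {(i, q). q \<in> four_squares (n - i\<^sup>2)}"

lemma finite_four_squares [simp, intro]: "finite (four_squares n)"
proof (rule finite_subset)
  show "four_squares n \<subseteq> {-n..n} \<times> {-n..n} \<times> {-n..n} \<times> {-n..n}"
  proof
    fix q
    assume "q \<in> four_squares n"
    then obtain a b c d where q: "q = (a, b, c, d)" and n: "a\<^sup>2 + b\<^sup>2 + c\<^sup>2 + d\<^sup>2 = n"
      by (auto simp: four_squares_def)
    show "q \<in> {-n..n} \<times> {-n..n} \<times> {-n..n} \<times> {-n..n}"
      unfolding q mem_Times_iff atLeastAtMost_iff fst_conv snd_conv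
      using n abs_le_square[of a] abs_le_square[of b] abs_le_square[of c] abs_le_square[of d]
      by (intro conjI) linarith+
  qed
qed auto

lemma four_squares_negative:
  assumes "n < 0"
  shows "four_squares n = {}"
proof -
  have "a\<^sup>2 + b\<^sup>2 + c\<^sup>2 + d\<^sup>2 \<noteq> n" for a b c d :: int
    using assms zero_le_power2[of a] zero_le_power2[of b] zero_le_power2[of c] zero_le_power2[of d]
    by linarith
  then show ?thesis by (simp add: four_squares_def)
qed

lemma four_squares_zero: "four_squares 0 = {(0, 0, 0, 0)}"
proof -
  have "a\<^sup>2 + b\<^sup>2 + c\<^sup>2 + d\<^sup>2 = 0 \<longleftrightarrow> a = 0 \<and> b = 0 \<and> c = 0 \<and> d = 0" for a b c d :: int
    by (simp add: add_nonneg_eq_0_iff)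
  then show ?thesis by (simp only: four_squares_def) auto
qed

lemma five_squares_Sigma: "five_squares n = Sigma {-n..n} (\<lambda>i. four_squares (n - i\<^sup>2))"
proof -
  have "-n \<le> i \<and> i \<le> n" if "q \<in> four_squares (n - i\<^sup>2)" for i q
  proof -
    have "0 \<le> n - i\<^sup>2" using that four_squares_negative[of "n - i\<^sup>2"] by force
    then show ?thesis using abs_le_square[of i] by linarith
  qed
  then show ?thesis by (simp add: five_squares_def set_eq_iff) blast
qed

text \<open>Permuting coordinates shows that the squares of all five coordinates have the same sum \<open>S\<close> over the
  representations of \<open>n\<close> by five squares. Hence \<open>n - 5 i\<^sup>2\<close>, the sum of the five squares minus \<open>5 i\<^sup>2\<close>, has
  sum \<open>5 S - 5 S = 0\<close>.\<close>

lemma r4_recursion: "(\<Sum>i \<in> {-n..n}. (n - 5 * i\<^sup>2) * r4 (n - i\<^sup>2)) = 0"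
proof -
  define X where "X = five_squares n"
  define S where "S = (\<Sum>(i, a, b, c, d) \<in> X. i\<^sup>2)"
  note reidx = sum.reindex_bij_witness
  have Sa: "(\<Sum>(i, a, b, c, d) \<in> X. a\<^sup>2) = S" unfolding S_def
    by (rule reidx[of _ "\<lambda>(i, a, b, c, d). (a, i, b, c, d)" "\<lambda>(i, a, b, c, d). (a, i, b, c, d)"])
       (auto simp: X_def five_squares_def four_squares_def)
  have Sb: "(\<Sum>(i, a, b, c, d) \<in> X. b\<^sup>2) = S" unfolding S_def
    by (rule reidx[of _ "\<lambda>(i, a, b, c, d). (b, a, i, c, d)" "\<lambda>(i, a, b, c, d). (b, a, i, c, d)"])
       (auto simp: X_def five_squares_def four_squares_def)
  have Sc: "(\<Sum>(i, a, b, c, d) \<in> X. c\<^sup>2) = S" unfolding S_def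
    by (rule reidx[of _ "\<lambda>(i, a, b, c, d). (c, a, b, i, d)" "\<lambda>(i, a, b, c, d). (c, a, b, i, d)"])
       (auto simp: X_def five_squares_def four_squares_def)
  have Sd: "(\<Sum>(i, a, b, c, d) \<in> X. d\<^sup>2) = S" unfolding S_def
    by (rule reidx[of _ "\<lambda>(i, a, b, c, d). (d, a, b, c, i)" "\<lambda>(i, a, b, c, d). (d, a, b, c, i)"])
       (auto simp: X_def five_squares_def four_squares_def)
  have "(\<Sum>i \<in> {-n..n}. (n - 5 * i\<^sup>2) * r4 (n - i\<^sup>2))
      = (\<Sum>i \<in> {-n..n}. \<Sum>q \<in> four_squares (n - i\<^sup>2). n - 5 * i\<^sup>2)"
    by (simp add: r4_def mult.commute)
  also have "\<dots> = (\<Sum>(i, q) \<in> X. n - 5 * i\<^sup>2)"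
    unfolding X_def five_squares_Sigma by (subst sum.Sigma) auto
  also have "\<dots> = (\<Sum>(i, a, b, c, d) \<in> X. i\<^sup>2 + a\<^sup>2 + b\<^sup>2 + c\<^sup>2 + d\<^sup>2 - 5 * i\<^sup>2)"
    by (intro sum.cong) (auto simp: X_def five_squares_def four_squares_def)
  also have "\<dots> = S + (\<Sum>(i, a, b, c, d) \<in> X. a\<^sup>2) + (\<Sum>(i, a, b, c, d) \<in> X. b\<^sup>2)
      + (\<Sum>(i, a, b, c, d) \<in> X. c\<^sup>2) + (\<Sum>(i, a, b, c, d) \<in> X. d\<^sup>2) - 5 * S"
    unfolding S_def sum_distrib_left sum.distrib[symmetric] sum_subtractf[symmetric]
    by (intro sum.cong) auto
  finally show ?thesis unfolding Sa Sb Sc Sd by simp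
qed

lemma square_recursion_unique:
  fixes f g :: "int \<Rightarrow> int"
  assumes neg: "\<And>n. n < 0 \<Longrightarrow> f n = g n" and zero: "f 0 = g 0"
    and f: "\<And>n. 0 < n \<Longrightarrow> (\<Sum>i \<in> {-n..n}. (n - 5 * i\<^sup>2) * f (n - i\<^sup>2)) = 0"
    and g: "\<And>n. 0 < n \<Longrightarrow> (\<Sum>i \<in> {-n..n}. (n - 5 * i\<^sup>2) * g (n - i\<^sup>2)) = 0"
  shows "f n = g n"
proof (induction "nat n" arbitrary: n rule: less_induct)
  case less
  show ?case
  proof (cases "0 < n")
    case True
    have smaller: "f (n - i\<^sup>2) = g (n - i\<^sup>2)" if "i \<noteq> 0" for i
    proof (rule less)
      have "0 < i\<^sup>2" using that by simp
      then show "nat (n - i\<^sup>2) < nat n" using True by linarith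
    qed
    have split: "(\<Sum>i \<in> {-n..n}. (n - 5 * i\<^sup>2) * h (n - i\<^sup>2))
        = n * h n + (\<Sum>i \<in> {-n..n} - {0}. (n - 5 * i\<^sup>2) * h (n - i\<^sup>2))" for h :: "int \<Rightarrow> int"
      using True by (subst sum.remove[of _ 0]) auto
    have "(\<Sum>i \<in> {-n..n} - {0}. (n - 5 * i\<^sup>2) * f (n - i\<^sup>2))
        = (\<Sum>i \<in> {-n..n} - {0}. (n - 5 * i\<^sup>2) * g (n - i\<^sup>2))"
      by (intro sum.cong) (auto simp: smaller)
    then have "n * f n = n * g n" using f[OF True] g[OF True] unfolding split by linarith
    then show ?thesis using True by simp
  next
    case False
    then show ?thesis using neg zero by (cases "n = 0") auto
  qed
qed

lemma divpairs_nonpositive: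
  assumes "n \<le> 0"
  shows "divpairs n = {}"
proof -
  have "\<not> (0 < d \<and> 0 < e \<and> d * e = n)" for d e
    using assms mult_pos_pos[of d e] by linarith
  then show ?thesis by (simp add: divpairs_def)
qed

lemma r4_eq_four_squares_value: "r4 n = four_squares_value n"
proof (rule square_recursion_unique[of r4 four_squares_value])
  show "r4 m = four_squares_value m" if "m < 0" for m
    using that by (simp add: r4_def four_squares_value_def four_squares_negative divpairs_nonpositive)
  show "r4 0 = four_squares_value 0"
    by (simp add: r4_def four_squares_value_def four_squares_zero divpairs_nonpositive)
qed (use r4_recursion four_squares_value_recursion in auto)

section \<open>Divisor sums with parity conditions\<close>

text \<open>This is \<open>\<sigma>\<^sub>k(n/c)\<close>, with the convention that \<open>\<sigma>\<^sub>k\<close> vanishes at non-integers.\<close>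

definition sigma_quot :: "nat \<Rightarrow> int \<Rightarrow> int \<Rightarrow> int" where
  "sigma_quot k c n = (if c dvd n then sigma k (n div c) else 0)"

lemma sum_divpairs_even_left:
  fixes f :: "int \<Rightarrow> int \<Rightarrow> int"
  shows "(\<Sum>(d, e) \<in> divpairs n. if even d then f d e else 0)
    = (if even n then \<Sum>(d, e) \<in> divpairs (n div 2). f (2 * d) e else 0)"
proof (cases "even n")
  case True
  then obtain m where m: "n = 2 * m" by (auto elim: evenE)
  have "(\<Sum>(d, e) \<in> divpairs n. if even d then f d e else 0)
      = (\<Sum>(d, e) \<in> {(d, e) \<in> divpairs n. even d}. f d e)"
    by (rule sum.mono_neutral_cong_right) (auto split: if_splits)
  also have "\<dots> = (\<Sum>(d, e) \<in> divpairs m. f (2 * d) e)"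
    by (rule sum.reindex_bij_witness[of _ "\<lambda>(d, e). (2 * d, e)" "\<lambda>(d, e). (d div 2, e)"])
       (auto simp: divpairs_def m)
  finally show ?thesis by (simp add: m)
next
  case False
  then show ?thesis by (auto simp: divpairs_def intro!: sum.neutral)
qed

lemma sum_divpairs_swap:
  fixes f :: "int \<Rightarrow> int \<Rightarrow> int"
  shows "(\<Sum>(d, e) \<in> divpairs n. f d e) = (\<Sum>(d, e) \<in> divpairs n. f e d)"
  by (rule sum.reindex_bij_witness[of _ "\<lambda>(d, e). (e, d)" "\<lambda>(d, e). (e, d)"])
     (auto simp: divpairs_def mult.commute)

lemma sum_divpairs_even_right:
  fixes f :: "int \<Rightarrow> int \<Rightarrow> int"
  shows "(\<Sum>(d, e) \<in> divpairs n. if even e then f d e else 0)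
    = (if even n then \<Sum>(d, e) \<in> divpairs (n div 2). f d (2 * e) else 0)"
  using sum_divpairs_swap[of "\<lambda>d e. if even e then f d e else 0" n]
    sum_divpairs_even_left[of "\<lambda>d e. f e d" n]
    sum_divpairs_swap[of "\<lambda>d e. f d (2 * e)" "n div 2"] by simp

lemma sum_even_divisors:
  "(\<Sum>(d, e) \<in> divpairs n. if even d then d ^ k else 0) = 2 ^ k * sigma_quot k 2 n"
  by (subst sum_divpairs_even_left)
     (simp add: sigma_quot_def sigma_def power_mult_distrib sum_distrib_left case_prod_unfold)

definition odd_sigma :: "nat \<Rightarrow> int \<Rightarrow> int" where
  "odd_sigma k n = (\<Sum>(d, e) \<in> divpairs n. if odd d then d ^ k else 0)"

lemma sigma_odd_even: "sigma k n = odd_sigma k n + 2 ^ k * sigma_quot k 2 n"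
  unfolding sum_even_divisors[symmetric] odd_sigma_def sigma_def sum.distrib[symmetric]
  by (intro sum.cong) auto

lemma odd_sigma_double: "odd_sigma k (2 * m) = odd_sigma k m"
proof -
  have "odd_sigma k (2 * m) = (\<Sum>(d, e) \<in> divpairs (2 * m). if even e then (if odd d then d ^ k else 0) else 0)"
    unfolding odd_sigma_def
  proof (intro sum.cong refl)
    fix p
    assume "p \<in> divpairs (2 * m)"
    then obtain d e where p: "p = (d, e)" and de: "d * e = 2 * m" by (auto simp: divpairs_def)
    have "even (d * e)" using de by simp
    then show "(case p of (d, e) \<Rightarrow> if odd d then d ^ k else 0) =
        (case p of (d, e) \<Rightarrow> if even e then (if odd d then d ^ k else 0) else 0)"
      by (auto simp: p)
  qed
  also have "\<dots> = odd_sigma k m"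
    unfolding odd_sigma_def by (subst sum_divpairs_even_right) simp
  finally show ?thesis .
qed

lemma sum_jacobi_weight:
  "(\<Sum>(d, e) \<in> divpairs n. jacobi_weight d e) = (if odd n then 1 else 3) * odd_sigma 1 n"
proof -
  have "(\<Sum>(d, e) \<in> divpairs n. jacobi_weight d e)
      = (\<Sum>(d, e) \<in> divpairs n. (if odd n then 1 else 3) * (if odd d then d ^ 1 else 0))"
    by (intro sum.cong) (auto simp: divpairs_def jacobi_weight_def)
  then show ?thesis unfolding odd_sigma_def sum_distrib_left by (simp only: case_prod_unfold)
qed

lemma sum_jacobi_weight_sigma:
  "(\<Sum>(d, e) \<in> divpairs n. jacobi_weight d e) = sigma 1 n - 4 * sigma_quot 1 4 n"
proof (cases "even n")
  case False
  then have "sigma_quot 1 2 n = 0" "sigma_quot 1 4 n = 0" by (auto simp: sigma_quot_def)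
  then show ?thesis using False sigma_odd_even[of 1 n] by (simp add: sum_jacobi_weight)
next
  case True
  then obtain m where m: "n = 2 * m" by (auto elim: evenE)
  have "sigma_quot 1 2 n = sigma 1 m" "sigma_quot 1 2 m = sigma_quot 1 4 n"
    by (auto simp: sigma_quot_def m)
  then show ?thesis
    using sigma_odd_even[of 1 n] sigma_odd_even[of 1 m] odd_sigma_double[of 1 m]
    by (simp add: sum_jacobi_weight m)
qed

lemma four_squares_value_sigma:
  "four_squares_value n = (if n = 0 then 1 else 0) + (8 * sigma 1 n - 32 * sigma_quot 1 4 n)"
  unfolding four_squares_value_def sum_jacobi_weight_sigma by simp

section \<open>Convolutions of divisor sums\<close>

lemma sum_of_squares:
  fixes d :: int
  assumes "0 < d"
  shows "6 * (\<Sum>l \<in> {1..<d}. l\<^sup>2) = (d - 1) * d * (2 * d - 1)"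
proof -
  have "6 * (\<Sum>l \<in> {1..<1 + int k}. l\<^sup>2) = int k * (int k + 1) * (2 * int k + 1)" for k
  proof (induction k)
    case (Suc k)
    have "{1..<1 + int (Suc k)} = insert (1 + int k) {1..<1 + int k}" by auto
    then show ?case using Suc by (simp add: algebra_simps power2_eq_square)
  qed simp
  from this[of "nat (d - 1)"] show ?thesis using assms by simp
qed

lemma sum_of_even_squares:
  fixes d :: int
  assumes "0 < d"
  shows "6 * (\<Sum>l \<in> {1..<d}. if even l then l\<^sup>2 else 0)
    = (if odd d then d ^ 3 - d else d ^ 3 - 3 * d\<^sup>2 + 2 * d)"
proof -
  have "6 * (\<Sum>l \<in> {1..<1 + int k}. if even l then l\<^sup>2 else 0)
      = (let d = 1 + int k in if odd d then d ^ 3 - d else d ^ 3 - 3 * d\<^sup>2 + 2 * d)" for k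
  proof (induction k)
    case (Suc k)
    have "{1..<1 + int (Suc k)} = insert (1 + int k) {1..<1 + int k}" by auto
    then show ?case using Suc
      by (cases "even k") (simp_all add: Let_def algebra_simps power2_eq_square power3_eq_cube)
  qed simp
  from this[of "nat (d - 1)"] show ?thesis using assms by (simp add: Let_def)
qed

text \<open>Liouville's identity for \<open>f(t) = t\<^sup>2\<close>, where \<open>f(a - b) - f(a + b) = - 4 a b\<close>. Summed over
  \<open>a x + b y = n\<close>, the product \<open>a b\<close> yields the convolution \<open>W\<^bsub>(1,1)\<^esub>(n)\<close>.\<close>

lemma besge_identity:
  "12 * (\<Sum>(a, b, x, y) \<in> quads n. a * b) = 5 * sigma 3 n - 6 * n * sigma 1 n + sigma 1 n"
proof -
  have "- 12 * (\<Sum>(a, b, x, y) \<in> quads n. a * b)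
      = 3 * (\<Sum>(a, b, x, y) \<in> quads n. (a - b)\<^sup>2 - (a + b)\<^sup>2)"
    unfolding sum_distrib_left by (intro sum.cong) (auto simp: power2_eq_square algebra_simps)
  also have "\<dots> = 3 * (\<Sum>(d, e) \<in> divpairs n.
      (0\<^sup>2 + 2 * d\<^sup>2) * (e - 1) - d\<^sup>2 * (d - 1) - 2 * (\<Sum>l \<in> {1..<d}. l\<^sup>2))"
    by (subst liouville_identity[of "\<lambda>t. t\<^sup>2"]) auto
  also have "\<dots> = (\<Sum>(d, e) \<in> divpairs n. 6 * n * d - 5 * d ^ 3 - d)"
  proof (subst sum_distrib_left, intro sum.cong refl)
    fix p
    assume "p \<in> divpairs n"
    then obtain d e where p: "p = (d, e)" and d: "0 < d" and n: "n = d * e" by (auto simp: divpairs_def)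
    have "3 * ((0\<^sup>2 + 2 * d\<^sup>2) * (e - 1) - d\<^sup>2 * (d - 1) - 2 * (\<Sum>l \<in> {1..<d}. l\<^sup>2))
        = 3 * (2 * d\<^sup>2 * (e - 1) - d\<^sup>2 * (d - 1)) - 6 * (\<Sum>l \<in> {1..<d}. l\<^sup>2)" by simp
    also have "\<dots> = 6 * n * d - 5 * d ^ 3 - d"
      unfolding sum_of_squares[OF d] n by (simp add: algebra_simps power2_eq_square power3_eq_cube)
    finally show "3 * (case p of (d, e) \<Rightarrow>
        (0\<^sup>2 + 2 * d\<^sup>2) * (e - 1) - d\<^sup>2 * (d - 1) - 2 * (\<Sum>l \<in> {1..<d}. l\<^sup>2))
      = (case p of (d, e) \<Rightarrow> 6 * n * d - 5 * d ^ 3 - d)" by (simp add: p)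
  qed
  also have "\<dots> = 6 * n * sigma 1 n - 5 * sigma 3 n - sigma 1 n"
    by (simp add: sigma_def case_prod_unfold sum_subtractf sum_distrib_left)
  finally show ?thesis by simp
qed

text \<open>Grouping the terms by \<open>l = a x\<close> shows that this is the sum over \<open>0 < l < n\<close> of the product of the
  odd divisor sums of \<open>l\<close> and \<open>n - l\<close>.\<close>

definition odd_conv :: "int \<Rightarrow> int" where
  "odd_conv n = (\<Sum>(a, b, x, y) \<in> quads n. if odd a \<and> odd b then a * b else 0)"

lemma sum_quads_even:
  "(\<Sum>(a, b, x, y) \<in> quads n. if even a \<and> even b then a * b else 0)
    = (if even n then 4 * (\<Sum>(a, b, x, y) \<in> quads (n div 2). a * b) else 0)"
proof (cases "even n")
  case True
  then obtain m where m: "n = 2 * m" by (auto elim: evenE)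
  have "(\<Sum>(a, b, x, y) \<in> quads n. if even a \<and> even b then a * b else 0)
      = (\<Sum>(a, b, x, y) \<in> {(a, b, x, y) \<in> quads n. even a \<and> even b}. a * b)"
    by (rule sum.mono_neutral_cong_right) (auto split: if_splits)
  also have "\<dots> = (\<Sum>(a, b, x, y) \<in> quads m. 4 * (a * b))"
    by (rule sum.reindex_bij_witness[of _ "\<lambda>(a, b, x, y). (2 * a, 2 * b, x, y)"
          "\<lambda>(a, b, x, y). (a div 2, b div 2, x, y)"]) (auto simp: quads_def m elim!: evenE)
  finally show ?thesis by (simp add: m sum_distrib_left case_prod_unfold)
next
  case False
  then show ?thesis by (auto simp: quads_def intro!: sum.neutral)
qed

text \<open>For \<open>f(t) = t\<^sup>2\<close> on even \<open>t\<close> and \<open>f(t) = 0\<close> on odd \<open>t\<close>, the difference \<open>f(a - b) - f(a + b)\<close> is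
  \<open>- 4 a b\<close> when \<open>a\<close> and \<open>b\<close> have the same parity and \<open>0\<close> otherwise. The pairs of even \<open>a\<close>, \<open>b\<close> are
  removed by \<open>besge_identity\<close> at \<open>n/2\<close>, and with them the terms \<open>n \<sigma>(n/2)\<close> disappear.\<close>

lemma odd_conv_value:
  "12 * odd_conv n = odd_sigma 3 n + 12 * sigma_quot 3 2 n - odd_sigma 1 n"
proof -
  define f :: "int \<Rightarrow> int" where "f t = (if even t then t\<^sup>2 else 0)" for t
  define E where "E = (\<Sum>(a, b, x, y) \<in> quads n. if even a \<and> even b then a * b else 0)"
  have "- 12 * (odd_conv n + E) = 3 * (\<Sum>(a, b, x, y) \<in> quads n. f (a - b) - f (a + b))"
    unfolding odd_conv_def E_def sum.distrib[symmetric] sum_distrib_left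
    by (intro sum.cong) (auto simp: f_def power2_eq_square algebra_simps)
  also have "\<dots> = 3 * (\<Sum>(d, e) \<in> divpairs n.
      (f 0 + 2 * f d) * (e - 1) - f d * (d - 1) - 2 * (\<Sum>l \<in> {1..<d}. f l))"
    by (subst liouville_identity) (auto simp: f_def)
  also have "\<dots> = (\<Sum>(d, e) \<in> divpairs n.
      6 * n * (if even d then d ^ 1 else 0) - 4 * (if even d then d ^ 3 else 0)
      - 2 * (if even d then d ^ 1 else 0) - (if odd d then d ^ 3 else 0) + (if odd d then d ^ 1 else 0))"
  proof (subst sum_distrib_left, intro sum.cong refl)
    fix p
    assume "p \<in> divpairs n"
    then obtain d e where p: "p = (d, e)" and d: "0 < d" and n: "n = d * e" by (auto simp: divpairs_def)
    have "3 * ((f 0 + 2 * f d) * (e - 1) - f d * (d - 1) - 2 * (\<Sum>l \<in> {1..<d}. f l))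
        = 3 * (2 * f d * (e - 1) - f d * (d - 1)) - 6 * (\<Sum>l \<in> {1..<d}. f l)" by (simp add: f_def)
    also have "\<dots> = 6 * n * (if even d then d ^ 1 else 0) - 4 * (if even d then d ^ 3 else 0)
      - 2 * (if even d then d ^ 1 else 0) - (if odd d then d ^ 3 else 0) + (if odd d then d ^ 1 else 0)"
      unfolding f_def sum_of_even_squares[OF d] n by (simp add: algebra_simps power2_eq_square power3_eq_cube)
    finally show "3 * (case p of (d, e) \<Rightarrow>
        (f 0 + 2 * f d) * (e - 1) - f d * (d - 1) - 2 * (\<Sum>l \<in> {1..<d}. f l))
      = (case p of (d, e) \<Rightarrow> 6 * n * (if even d then d ^ 1 else 0) - 4 * (if even d then d ^ 3 else 0)
      - 2 * (if even d then d ^ 1 else 0) - (if odd d then d ^ 3 else 0) + (if odd d then d ^ 1 else 0))"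
      by (simp add: p)
  qed
  also have "\<dots> = 6 * n * (2 ^ 1 * sigma_quot 1 2 n) - 4 * (2 ^ 3 * sigma_quot 3 2 n)
      - 2 * (2 ^ 1 * sigma_quot 1 2 n) - odd_sigma 3 n + odd_sigma 1 n"
    unfolding sum_even_divisors[symmetric] odd_sigma_def sum_distrib_left
      sum_subtractf[symmetric] sum.distrib[symmetric]
    by (intro sum.cong) auto
  finally have main: "- 12 * (odd_conv n + E) = 12 * n * sigma_quot 1 2 n - 32 * sigma_quot 3 2 n
      - 4 * sigma_quot 1 2 n - odd_sigma 3 n + odd_sigma 1 n" by simp
  have "12 * E = 20 * sigma_quot 3 2 n - 12 * n * sigma_quot 1 2 n + 4 * sigma_quot 1 2 n"
  proof (cases "even n")
    case True
    then obtain m where m: "n = 2 * m" by (auto elim: evenE)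
    have "12 * E = 4 * (12 * (\<Sum>(a, b, x, y) \<in> quads m. a * b))"
      unfolding E_def sum_quads_even by (simp add: m)
    then show ?thesis unfolding besge_identity by (simp add: sigma_quot_def m)
  next
    case False
    then show ?thesis unfolding E_def sum_quads_even by (simp add: sigma_quot_def)
  qed
  then show ?thesis using main by simp
qed

text \<open>If \<open>a x + b y\<close> is odd, then exactly one of \<open>a x\<close>, \<open>b y\<close> is even, which gives one factor \<open>3\<close>; if it
  is even and \<open>a\<close>, \<open>b\<close> are odd, then \<open>x\<close> and \<open>y\<close> have the same parity, and for even \<open>x\<close>, \<open>y\<close> the weight
  has the factor \<open>9 = 1 + 8\<close>.\<close>

lemma sum_quads_jacobi_weight_odd:
  assumes "odd n"
  shows "(\<Sum>(a, b, x, y) \<in> quads n. jacobi_weight a x * jacobi_weight b y) = 3 * odd_conv n"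
  unfolding odd_conv_def sum_distrib_left
  by (intro sum.cong) (use assms in \<open>auto simp: quads_def jacobi_weight_def\<close>)

lemma sum_quads_jacobi_weight_even:
  "(\<Sum>(a, b, x, y) \<in> quads (2 * m). jacobi_weight a x * jacobi_weight b y)
    = odd_conv (2 * m) + 8 * odd_conv m"
proof -
  define R where "R = {(a, b, x, y) \<in> quads (2 * m). even x \<and> even y}"
  have "(\<Sum>(a, b, x, y) \<in> quads (2 * m). if even x \<and> even y then (if odd a \<and> odd b then a * b else 0) else 0)
      = (\<Sum>(a, b, x, y) \<in> R. if odd a \<and> odd b then a * b else 0)"
    by (rule sum.mono_neutral_cong_right) (auto simp: R_def split: if_splits)
  also have "\<dots> = odd_conv m"
    unfolding odd_conv_def
    by (rule sum.reindex_bij_witness[of _ "\<lambda>(a, b, x, y). (a, b, 2 * x, 2 * y)"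
          "\<lambda>(a, b, x, y). (a, b, x div 2, y div 2)"]) (auto simp: R_def quads_def elim!: evenE)
  finally have half: "odd_conv m = (\<Sum>(a, b, x, y) \<in> quads (2 * m).
      if even x \<and> even y then (if odd a \<and> odd b then a * b else 0) else 0)" by simp
  show ?thesis
    unfolding half unfolding odd_conv_def sum_distrib_left sum.distrib[symmetric]
  proof (intro sum.cong refl)
    fix q
    assume "q \<in> quads (2 * m)"
    then obtain a b x y where q: "q = (a, b, x, y)" and "a * x + b * y = 2 * m"
      by (auto simp: quads_def)
    then have "even (a * x + b * y)" by simp
    then show "(case q of (a, b, x, y) \<Rightarrow> jacobi_weight a x * jacobi_weight b y)
      = (case q of (a, b, x, y) \<Rightarrow> if odd a \<and> odd b then a * b else 0)
      + 8 * (case q of (a, b, x, y) \<Rightarrow>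
          if even x \<and> even y then (if odd a \<and> odd b then a * b else 0) else 0)"
      by (auto simp: q jacobi_weight_def)
  qed
qed

text \<open>For even \<open>n\<close> the odd divisor sums of \<open>n\<close> and \<open>n/2\<close> agree. For exponent \<open>1\<close> they cancel out, with
  total coefficient \<open>48 - 16/3 - 128/3 = 0\<close>; for exponent \<open>3\<close> their equality is the relation
  \<open>\<sigma>\<^sub>3(n) = 9 \<sigma>\<^sub>3(n/2) - 8 \<sigma>\<^sub>3(n/4)\<close>, which brings the result into the stated form.\<close>

lemma eight_squares_value:
  "16 * (\<Sum>(d, e) \<in> divpairs n. jacobi_weight d e)
      + 64 * (\<Sum>(a, b, x, y) \<in> quads n. jacobi_weight a x * jacobi_weight b y)
    = 16 * sigma 3 n - 32 * sigma_quot 3 2 n + 256 * sigma_quot 3 4 n"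
proof (cases "even n")
  case False
  then have "sigma_quot 3 2 n = 0" "sigma_quot 3 4 n = 0" by (auto simp: sigma_quot_def)
  then show ?thesis
    using False sigma_odd_even[of 3 n] odd_conv_value[of n]
    by (simp add: sum_jacobi_weight sum_quads_jacobi_weight_odd)
next
  case True
  then obtain m where m: "n = 2 * m" by (auto elim: evenE)
  have "sigma_quot 3 2 n = sigma 3 m" "sigma_quot 3 2 m = sigma_quot 3 4 n"
    by (auto simp: sigma_quot_def m)
  then show ?thesis
    using sigma_odd_even[of 3 n] sigma_odd_even[of 3 m] odd_conv_value[of n] odd_conv_value[of m]
      odd_sigma_double[of 1 m] odd_sigma_double[of 3 m]
    by (simp add: sum_jacobi_weight sum_quads_jacobi_weight_even m)
qed

section \<open>Representations by pairs of quadruples\<close>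

lemma divisor_sigma_of_nat: "divisor_sigma k (of_nat n) = sigma k (int n)"
proof (cases "n = 0")
  case True
  then show ?thesis by (simp add: divisor_sigma_def sigma_def divpairs_nonpositive)
next
  case False
  have "(\<Sum>d | 0 < d \<and> d dvd n. int d ^ k) = (\<Sum>(d, e) \<in> divpairs (int n). d ^ k)"
  proof (rule sum.reindex_bij_witness[of _ "\<lambda>(d, e). nat d" "\<lambda>d. (int d, int (n div d))"])
    fix d
    assume "d \<in> {d. 0 < d \<and> d dvd n}"
    then obtain e where "0 < d" "n = d * e" by auto
    then show "(int d, int (n div d)) \<in> divpairs (int n)" using False by (simp add: divpairs_def)
  next
    fix p
    assume "p \<in> divpairs (int n)"
    then obtain d e where p: "p = (d, e)" and de: "0 < d" "0 < e" "d * e = int n"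
      by (auto simp: divpairs_def)
    have n: "n = nat d * nat e" using de by (metis nat_int nat_mult_distrib less_imp_le)
    show "(case p of (d, e) \<Rightarrow> nat d) \<in> {d. 0 < d \<and> d dvd n}" using de by (simp add: p n)
    show "(int (case p of (d, e) \<Rightarrow> nat d), int (n div (case p of (d, e) \<Rightarrow> nat d))) = p"
      using de by (simp add: p n)
  qed auto
  then show ?thesis using False by (simp add: divisor_sigma_def sigma_def)
qed

lemma divisor_sigma_quotient:
  assumes "0 < c"
  shows "divisor_sigma k (of_nat n / of_nat c) = (if c dvd n then divisor_sigma k (of_nat (n div c)) else 0)"
proof (cases "c dvd n")
  case True
  then obtain j where "n = c * j" by auto
  then show ?thesis using assms by simp
next
  case False
  have "(of_nat n / of_nat c :: rat) \<notin> \<nat>"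
  proof
    assume "(of_nat n / of_nat c :: rat) \<in> \<nat>"
    then obtain j where "of_nat n / of_nat c = (of_nat j :: rat)" by (auto elim: Nats_cases)
    then have "(of_nat n :: rat) = of_nat (c * j)" using assms by (simp add: field_simps)
    then have "n = c * j" by (simp only: of_nat_eq_iff)
    with False show False by simp
  qed
  then show ?thesis using False by (simp add: divisor_sigma_def)
qed

lemma sigma_quot_of_nat:
  assumes "0 < c"
  shows "sigma_quot k (int c) (int n) = divisor_sigma k (of_nat n / of_nat c)"
  unfolding divisor_sigma_quotient[OF assms] divisor_sigma_of_nat sigma_quot_def
  by (simp add: zdiv_int)

definition lin_reps :: "nat \<Rightarrow> nat \<Rightarrow> nat \<Rightarrow> (nat \<times> nat) set" where
  "lin_reps a b n = {(l, m). a * l + b * m = n}"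

lemma finite_lin_reps:
  assumes "0 < a" "0 < b"
  shows "finite (lin_reps a b n)"
proof (rule finite_subset)
  show "lin_reps a b n \<subseteq> {..n} \<times> {..n}"
  proof
    fix p
    assume "p \<in> lin_reps a b n"
    then obtain l m where p: "p = (l, m)" and n: "a * l + b * m = n" by (auto simp: lin_reps_def)
    have "l \<le> a * l" "m \<le> b * m" using assms by simp_all
    then have "l \<le> n" "m \<le> n" using n by linarith+
    then show "p \<in> {..n} \<times> {..n}" by (simp add: p)
  qed
qed auto

lemma conv_W_lin_reps:
  "conv_W a b (of_nat n) = (\<Sum>(l, m) \<in> lin_reps a b n. sigma1 (of_nat l) * sigma1 (of_nat m))"
  unfolding conv_W_def lin_reps_def of_nat_eq_iff ..

lemma conv_W_commute: "conv_W a b q = conv_W b a q"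
  unfolding conv_W_def
  by (rule sum.reindex_bij_witness[of _ "\<lambda>(l, m). (m, l)" "\<lambda>(l, m). (m, l)"])
     (auto simp: algebra_simps)

lemma conv_W_quotient:
  assumes "0 < c"
  shows "conv_W a b (of_nat n / of_nat c) = conv_W (c * a) (c * b) (of_nat n)"
proof -
  have "of_nat (a * l + b * m) = (of_nat n / of_nat c :: rat)
      \<longleftrightarrow> of_nat (c * a * l + c * b * m) = (of_nat n :: rat)" for l m
    using assms by (simp add: field_simps)
  then show ?thesis unfolding conv_W_def by simp
qed

lemma sum_lin_reps_quotient_left:
  fixes g :: "nat \<Rightarrow> nat \<Rightarrow> int"
  assumes "0 < a" "0 < b" "0 < c"
  shows "(\<Sum>(l, m) \<in> lin_reps a b n. if c dvd l then g (l div c) m else 0)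
    = (\<Sum>(l, m) \<in> lin_reps (c * a) b n. g l m)"
proof -
  have "(\<Sum>(l, m) \<in> lin_reps a b n. if c dvd l then g (l div c) m else 0)
      = (\<Sum>(l, m) \<in> {(l, m) \<in> lin_reps a b n. c dvd l}. g (l div c) m)"
    by (rule sum.mono_neutral_cong_right) (use assms in \<open>auto simp: finite_lin_reps split: if_splits\<close>)
  also have "\<dots> = (\<Sum>(l, m) \<in> lin_reps (c * a) b n. g l m)"
    by (rule sum.reindex_bij_witness[of _ "\<lambda>(l, m). (c * l, m)" "\<lambda>(l, m). (l div c, m)"])
       (use assms in \<open>auto simp: lin_reps_def ac_simps\<close>)
  finally show ?thesis .
qed

lemma sum_lin_reps_swap:
  fixes g :: "nat \<Rightarrow> nat \<Rightarrow> int"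
  shows "(\<Sum>(l, m) \<in> lin_reps a b n. g l m) = (\<Sum>(m, l) \<in> lin_reps b a n. g l m)"
  by (rule sum.reindex_bij_witness[of _ "\<lambda>(l, m). (m, l)" "\<lambda>(l, m). (m, l)"])
     (auto simp: lin_reps_def)

lemma sum_lin_reps_quotient_right:
  fixes g :: "nat \<Rightarrow> nat \<Rightarrow> int"
  assumes "0 < a" "0 < b" "0 < c"
  shows "(\<Sum>(l, m) \<in> lin_reps a b n. if c dvd m then g l (m div c) else 0)
    = (\<Sum>(l, m) \<in> lin_reps a (c * b) n. g l m)"
  using sum_lin_reps_quotient_left[OF assms(2,1,3), of "\<lambda>m l. g l m" n]
  by (subst (1 2) sum_lin_reps_swap)

lemma sum_lin_reps_boundary:
  fixes f :: "nat \<Rightarrow> int"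
  assumes "0 < a" "0 < b"
  shows "(\<Sum>(l, m) \<in> lin_reps a b n. if l = 0 then f m else 0) = (if b dvd n then f (n div b) else 0)"
proof (cases "b dvd n")
  case True
  then obtain j where j: "n = b * j" by auto
  have "(\<Sum>(l, m) \<in> lin_reps a b n. if l = 0 then f m else 0) = (\<Sum>(l, m) \<in> {(0 :: nat, j)}. f m)"
  proof (rule sum.mono_neutral_cong_right)
    show "finite (lin_reps a b n)" using assms by (rule finite_lin_reps)
  qed (use assms in \<open>auto simp: lin_reps_def j split: if_splits\<close>)
  then show ?thesis using assms by (simp add: j)
next
  case False
  then show ?thesis by (auto simp: lin_reps_def intro!: sum.neutral)
qed

lemma num_reps_lin_reps:
  assumes "0 < a" "0 < b"
  shows "int (num_reps a b n) = (\<Sum>(l, m) \<in> lin_reps a b n. r4 (int l) * r4 (int m))"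
proof -
  define T where "T = {(x1, x2, x3, x4, x5, x6, x7, x8).
             int n = int a * (x1\<^sup>2 + x2\<^sup>2 + x3\<^sup>2 + x4\<^sup>2) + int b * (x5\<^sup>2 + x6\<^sup>2 + x7\<^sup>2 + x8\<^sup>2)}"
  define R where "R = Sigma (lin_reps a b n) (\<lambda>(l, m). four_squares (int l) \<times> four_squares (int m))"
  have lin: "a * l + b * m = n \<longleftrightarrow> int n = int a * int l + int b * int m" for l m
    by (simp flip: of_nat_mult of_nat_add) auto
  have "int (card T) = (\<Sum>t \<in> T. 1)" by simp
  also have "\<dots> = (\<Sum>(p, t) \<in> R. 1)"
    by (rule sum.reindex_bij_witness[of _
          "\<lambda>(p, (x1, x2, x3, x4), (x5, x6, x7, x8)). (x1, x2, x3, x4, x5, x6, x7, x8)"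
          "\<lambda>(x1, x2, x3, x4, x5, x6, x7, x8).
             ((nat (x1\<^sup>2 + x2\<^sup>2 + x3\<^sup>2 + x4\<^sup>2), nat (x5\<^sup>2 + x6\<^sup>2 + x7\<^sup>2 + x8\<^sup>2)),
              (x1, x2, x3, x4), (x5, x6, x7, x8))"])
       (auto simp: T_def R_def lin_reps_def four_squares_def lin)
  also have "\<dots> = (\<Sum>(l, m) \<in> lin_reps a b n. \<Sum>t \<in> four_squares (int l) \<times> four_squares (int m). 1)"
    unfolding R_def by (subst sum.Sigma[symmetric]) (use assms in \<open>auto simp: finite_lin_reps intro!: sum.cong\<close>)
  also have "\<dots> = (\<Sum>(l, m) \<in> lin_reps a b n. r4 (int l) * r4 (int m))"
    by (intro sum.cong) (auto simp: r4_def card_cartesian_product)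
  finally show ?thesis by (simp add: num_reps_def T_def)
qed

text \<open>The product of the two terms \<open>[l = 0]\<close> and \<open>[m = 0]\<close> does not contribute, as \<open>n > 0\<close>.\<close>

lemma num_reps_expand:
  fixes A :: "nat \<Rightarrow> int"
  assumes "0 < a" "0 < b" "0 < n"
    and A: "\<And>m. r4 (int m) = (if m = 0 then 1 else 0) + A m"
  shows "int (num_reps a b n) = (if a dvd n then A (n div a) else 0) + (if b dvd n then A (n div b) else 0)
    + (\<Sum>(l, m) \<in> lin_reps a b n. A l * A m)"
proof -
  have "int (num_reps a b n) = (\<Sum>(l, m) \<in> lin_reps a b n.
      (if m = 0 then A l else 0) + (if l = 0 then A m else 0) + A l * A m)"
    unfolding num_reps_lin_reps[OF assms(1,2)]
    by (intro sum.cong) (use assms(3) in \<open>auto simp: A lin_reps_def algebra_simps\<close>)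
  also have "\<dots> = (\<Sum>(l, m) \<in> lin_reps a b n. if m = 0 then A l else 0)
      + (\<Sum>(l, m) \<in> lin_reps a b n. if l = 0 then A m else 0) + (\<Sum>(l, m) \<in> lin_reps a b n. A l * A m)"
    unfolding sum.distrib[symmetric] by (intro sum.cong) auto
  also have "(\<Sum>(l, m) \<in> lin_reps a b n. if m = 0 then A l else 0)
      = (\<Sum>(m, l) \<in> lin_reps b a n. if m = 0 then A l else 0)"
    by (rule sum_lin_reps_swap)
  finally show ?thesis
    using sum_lin_reps_boundary[OF assms(1,2), of A n] sum_lin_reps_boundary[OF assms(2,1), of A n] by simp
qed

lemma jacobi_four_squares:
  "r4 (int m) = (if m = 0 then 1 else 0) + (8 * sigma1 (of_nat m) - 32 * sigma1 (of_nat m / 4))"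
  unfolding r4_eq_four_squares_value four_squares_value_sigma
  using sigma_quot_of_nat[of 4 1 m] by (simp add: divisor_sigma_of_nat)

text \<open>The function \<open>q\<close> in the proof is \<open>\<sigma>(m/4)\<close>. Substituting \<open>4 l\<close> for \<open>l\<close> where it occurs turns the
  coefficient \<open>a\<close> into \<open>4 a\<close>; if it occurs in both factors, then \<open>4 a l + 4 b m = n\<close> is
  \<open>a l + b m = n/4\<close>.\<close>

lemma num_reps_formula:
  assumes ab: "0 < a" "0 < b" and "0 < n"
  shows "int (num_reps a b n)
    = 8 * sigma1 (of_nat n / of_nat a) - 32 * sigma1 (of_nat n / of_nat (4 * a))
    + 8 * sigma1 (of_nat n / of_nat b) - 32 * sigma1 (of_nat n / of_nat (4 * b))
    + 64 * conv_W a b (of_nat n) + 1024 * conv_W a b (of_nat n / 4)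
    - 256 * (conv_W (4 * a) b (of_nat n) + conv_W a (4 * b) (of_nat n))"
proof -
  define s where "s m = sigma1 (of_nat m)" for m
  define q where "q m = (if 4 dvd m then s (m div 4) else 0)" for m
  have q: "sigma1 (of_nat m / 4) = q m" for m
    using divisor_sigma_quotient[of 4 1 m] by (simp add: q_def s_def)
  have r4: "r4 (int m) = (if m = 0 then 1 else 0) + (8 * s m - 32 * q m)" for m
    unfolding jacobi_four_squares s_def q ..
  have linear: "(if c dvd n then 8 * s (n div c) - 32 * q (n div c) else 0)
      = 8 * sigma1 (of_nat n / of_nat c) - 32 * sigma1 (of_nat n / of_nat (4 * c))" if "0 < c" for c
  proof (cases "c dvd n")
    case True
    then obtain j where j: "n = c * j" by auto
    have "of_nat n / of_nat c = (of_nat j :: rat)" "of_nat n / of_nat (4 * c) = (of_nat j / 4 :: rat)"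
      using that by (simp_all add: j)
    then show ?thesis using True that by (simp only: s_def q[symmetric]) (simp add: j)
  next
    case False
    then have "\<not> 4 * c dvd n" by (meson dvd_mult_right)
    then show ?thesis using False that by (simp add: divisor_sigma_quotient del: of_nat_mult)
  qed
  let ?P = "lin_reps a b n"
  have ss: "(\<Sum>(l, m) \<in> ?P. s l * s m) = conv_W a b (of_nat n)"
    unfolding conv_W_lin_reps s_def ..
  have qs: "(\<Sum>(l, m) \<in> ?P. q l * s m) = conv_W (4 * a) b (of_nat n)"
    using sum_lin_reps_quotient_left[OF ab, of 4 "\<lambda>l m. s l * s m" n]
    unfolding conv_W_lin_reps s_def[symmetric] q_def by (simp add: if_distrib[of "\<lambda>t. t * _"] cong: if_cong)
  have sq: "(\<Sum>(l, m) \<in> ?P. s l * q m) = conv_W a (4 * b) (of_nat n)"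
    using sum_lin_reps_quotient_right[OF ab, of 4 "\<lambda>l m. s l * s m" n]
    unfolding conv_W_lin_reps s_def[symmetric] q_def by (simp add: if_distrib[of "\<lambda>t. _ * t"] cong: if_cong)
  have qq: "(\<Sum>(l, m) \<in> ?P. q l * q m) = conv_W a b (of_nat n / 4)"
  proof -
    have "(\<Sum>(l, m) \<in> ?P. q l * q m) = (\<Sum>(l, m) \<in> lin_reps (4 * a) b n. s l * q m)"
      using sum_lin_reps_quotient_left[OF ab, of 4 "\<lambda>l m. s l * q m" n]
      by (simp add: q_def if_distrib[of "\<lambda>t. t * _"] cong: if_cong)
    also have "\<dots> = (\<Sum>(l, m) \<in> lin_reps (4 * a) (4 * b) n. s l * s m)"
      using sum_lin_reps_quotient_right[of "4 * a" b 4 "\<lambda>l m. s l * s m" n] ab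
      unfolding q_def by (simp add: if_distrib[of "\<lambda>t. _ * t"] cong: if_cong)
    also have "\<dots> = conv_W a b (of_nat n / 4)"
      using conv_W_quotient[of 4 a b n] by (simp add: conv_W_lin_reps s_def)
    finally show ?thesis .
  qed
  have "(\<Sum>(l, m) \<in> ?P. (8 * s l - 32 * q l) * (8 * s m - 32 * q m))
      = 64 * (\<Sum>(l, m) \<in> ?P. s l * s m) - 256 * (\<Sum>(l, m) \<in> ?P. s l * q m)
      - 256 * (\<Sum>(l, m) \<in> ?P. q l * s m) + 1024 * (\<Sum>(l, m) \<in> ?P. q l * q m)"
    unfolding sum_distrib_left sum.distrib[symmetric] sum_subtractf[symmetric]
    by (intro sum.cong) (auto simp: algebra_simps)
  then show ?thesis
    unfolding num_reps_expand[OF assms r4] linear[OF ab(1)] linear[OF ab(2)] ss qs sq qq by simp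
qed

lemma sum_lin_reps_quads:
  fixes f :: "int \<Rightarrow> int \<Rightarrow> int"
  shows "(\<Sum>(l, m) \<in> lin_reps 1 1 n. (\<Sum>(d, e) \<in> divpairs (int l). f d e) * (\<Sum>(d, e) \<in> divpairs (int m). f d e))
    = (\<Sum>(a, b, x, y) \<in> quads (int n). f a x * f b y)"
proof -
  define R where "R = Sigma (lin_reps 1 1 n) (\<lambda>(l, m). divpairs (int l) \<times> divpairs (int m))"
  have "(\<Sum>(l, m) \<in> lin_reps 1 1 n. (\<Sum>(d, e) \<in> divpairs (int l). f d e) * (\<Sum>(d, e) \<in> divpairs (int m). f d e))
      = (\<Sum>(l, m) \<in> lin_reps 1 1 n. \<Sum>((a, x), (b, y)) \<in> divpairs (int l) \<times> divpairs (int m). f a x * f b y)"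
    by (intro sum.cong) (auto simp: sum_product sum.cartesian_product case_prod_unfold)
  also have "\<dots> = (\<Sum>(p, (a, x), (b, y)) \<in> R. f a x * f b y)"
    unfolding R_def by (subst sum.Sigma[symmetric]) (auto simp: finite_lin_reps intro!: sum.cong)
  also have "\<dots> = (\<Sum>(a, b, x, y) \<in> quads (int n). f a x * f b y)"
    by (rule sum.reindex_bij_witness[of _
          "\<lambda>(a, b, x, y). ((nat (a * x), nat (b * y)), (a, x), (b, y))"
          "\<lambda>(p, (a, x), (b, y)). (a, b, x, y)"])
       (auto simp: R_def lin_reps_def quads_def divpairs_def nat_add_distrib[symmetric])
  finally show ?thesis .
qed

lemma eight_squares:
  assumes "0 < n"
  shows "int (num_reps 1 1 n)
    = 16 * divisor_sigma 3 (of_nat n) - 32 * divisor_sigma 3 (of_nat n / 2) + 256 * divisor_sigma 3 (of_nat n / 4)"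
proof -
  define w where "w m = (\<Sum>(d, e) \<in> divpairs (int m). jacobi_weight d e)" for m
  have r4: "r4 (int m) = (if m = 0 then 1 else 0) + 8 * w m" for m
    by (simp add: r4_eq_four_squares_value four_squares_value_def w_def)
  have "int (num_reps 1 1 n) = 16 * w n + (\<Sum>(l, m) \<in> lin_reps 1 1 n. (8 * w l) * (8 * w m))"
    using num_reps_expand[of 1 1, OF _ _ assms r4] by simp
  also have "(\<Sum>(l, m) \<in> lin_reps 1 1 n. (8 * w l) * (8 * w m)) = 64 * (\<Sum>(l, m) \<in> lin_reps 1 1 n. w l * w m)"
    unfolding sum_distrib_left by (intro sum.cong) auto
  also have "16 * w n + \<dots> = 16 * sigma 3 (int n) - 32 * sigma_quot 3 2 (int n) + 256 * sigma_quot 3 4 (int n)"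
    unfolding w_def sum_lin_reps_quads by (rule eight_squares_value)
  finally show ?thesis
    using sigma_quot_of_nat[of 2 3 n] sigma_quot_of_nat[of 4 3 n] by (simp add: divisor_sigma_of_nat)
qed

theorem corollary7p3:
  fixes n :: nat
  assumes "n > 0"
  shows "(int (num_reps 1 1 n) =
           16 * sigma1 (of_nat n) - 64 * sigma1 (of_nat n / 4)
           + 64 * conv_W 1 1 (of_nat n) + 1024 * conv_W 1 1 (of_nat n / 4) - 512 * conv_W 1 4 (of_nat n)) \<and>
         (16 * sigma1 (of_nat n) - 64 * sigma1 (of_nat n / 4)
           + 64 * conv_W 1 1 (of_nat n) + 1024 * conv_W 1 1 (of_nat n / 4) - 512 * conv_W 1 4 (of_nat n) =
         16 * divisor_sigma 3 (of_nat n) - 32 * divisor_sigma 3 (of_nat n / 2) + 256 * divisor_sigma 3 (of_nat n / 4)) \<and>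
         (int (num_reps 1 3 n) =
           8 * sigma1 (of_nat n) - 32 * sigma1 (of_nat n / 4) + 8 * sigma1 (of_nat n / 3) - 32 * sigma1 (of_nat n / 12)
           + 64 * conv_W 1 3 (of_nat n) + 1024 * conv_W 1 3 (of_nat n / 4)
           - 256 * (conv_W 3 4 (of_nat n) + conv_W 1 12 (of_nat n))) \<and>
         (int (num_reps 2 3 n) =
           8 * sigma1 (of_nat n / 2) - 32 * sigma1 (of_nat n / 8) + 8 * sigma1 (of_nat n / 3) - 32 * sigma1 (of_nat n / 12)
           + 64 * conv_W 2 3 (of_nat n) + 1024 * conv_W 2 3 (of_nat n / 4)
           - 256 * (conv_W 3 8 (of_nat n) + conv_W 2 12 (of_nat n))) \<and>
         (int (num_reps 1 9 n) =
           8 * sigma1 (of_nat n) - 32 * sigma1 (of_nat n / 4) + 8 * sigma1 (of_nat n / 9) - 32 * sigma1 (of_nat n / 36)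
           + 64 * conv_W 1 9 (of_nat n) + 1024 * conv_W 1 9 (of_nat n / 4)
           - 256 * (conv_W 4 9 (of_nat n) + conv_W 1 36 (of_nat n)))"
  using eight_squares[OF assms] num_reps_formula[of 1 1 n] num_reps_formula[of 1 3 n]
    num_reps_formula[of 2 3 n] num_reps_formula[of 1 9 n] assms
  by (simp add: conv_W_commute[of 4 "Suc 0"] conv_W_commute[of 4 3] conv_W_commute[of 8 3])

end
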